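(* Let $f\colon X\to X$ be a continuous map on a compact metric space $(X,d)$ whose topological entropy $h_{\mathrm{top}}(f)$ is finite and which preserves a Borel non-atomic probability measure $\mu$. Let $\varphi\colon X\to\mathbb{R}$ be a continuous potential. If $\mu$ is a weak-Gibbs measure for $f$ with respect to $\varphi$, then $\mu$ is an equilibrium state for $f$ and $\varphi$.
   Context: $P_{\mathrm{top}}(f,\varphi)$ denotes the usual topological pressure of $f$ and $\varphi$. For $x\in X$, $n\in\mathbb{N}$ (with $n\geq 1$) and $\varepsilon>0$, the $n$th dynamical ball is $B_n^f(x,\varepsilon)=\{y\in X:\ d(f^i(x),f^i(y))<\varepsilon\ \text{ for all } 0\le i\le n-1\}$, and the $n$th Birkhoff sum is $S_n^f\varphi(x)=\sum_{i=0}^{n-1}\varphi(f^i(x))$. A Borel probability measure $\mu$ is weak-Gibbs for $f$ with respect to $\varphi$ if there exist $\varepsilon_0>0$ and a subset $\Lambda\subset X$ with full $\mu$-measure such that, for every $0<\varepsilon<\varepsilon_0$ and every $x\in\Lambda$, there is a sequence of positive constants $(\delta_n(\varepsilon,x))_{n\in\mathbb{N}}$ satisfying $\lim_{n\to+\infty}\frac{\log\delta_n(\varepsilon,x)}{n}=0$ and, for every $n\in\mathbb{N}$, $$\delta_n(\varepsilon,x)^{-1}\le\frac{\mu(B_n^f(x,\varepsilon))}{\exp\big(-P_{\mathrm{top}}(f,\varphi)\,n+S_n^f\varphi(x)\big)}\le\delta_n(\varepsilon,x).$$ For a Borel $f$-invariant probability measure $\nu$, put $P_\nu(f,\varphi)=h_\nu(f)+\int\varphi\,d\nu$,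 where $h_\nu(f)$ is the metric entropy. A Borel $f$-invariant probability measure $\mu$ is an equilibrium state for $f$ and $\varphi$ if $P_\mu(f,\varphi)=\sup_\nu P_\nu(f,\varphi)$, where the supremum is over all Borel $f$-invariant probability measures $\nu$; by the Variational Principle this supremum equals $P_{\mathrm{top}}(f,\varphi)$. *)

theory Defs
  imports "HOL-Probability.Probability"
begin

text \<open>
  The compact metric space is the whole carrier of a type of class \<^class>\<open>metric_space\<close>; its
  compactness is a hypothesis wherever it is needed.
\<close>

definition dynamical_ball :: "('a::metric_space \<Rightarrow> 'a) \<Rightarrow> nat \<Rightarrow> 'a \<Rightarrow> real \<Rightarrow> 'a set" where
  "dynamical_ball f n x \<epsilon> = {y. \<forall>i<n. dist ((f ^^ i) x) ((f ^^ i) y) < \<epsilon>}"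

definition birkhoff_sum :: "('a \<Rightarrow> 'a) \<Rightarrow> ('a \<Rightarrow> real) \<Rightarrow> nat \<Rightarrow> 'a \<Rightarrow> real" where
  "birkhoff_sum f \<phi> n x = (\<Sum>i<n. \<phi> ((f ^^ i) x))"


subsection \<open>Topological entropy and topological pressure\<close>

definition separated :: "('a::metric_space \<Rightarrow> 'a) \<Rightarrow> nat \<Rightarrow> real \<Rightarrow> 'a set \<Rightarrow> bool" where
  "separated f n \<epsilon> E \<longleftrightarrow>
     finite E \<and> (\<forall>x\<in>E. \<forall>y\<in>E. x \<noteq> y \<longrightarrow> (\<exists>i<n. \<epsilon> < dist ((f ^^ i) x) ((f ^^ i) y)))"

text \<open>
  For continuous \<open>f\<close> on a compact space the cardinalities of the \<open>(n, \<epsilon>)\<close>-separated sets are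
  bounded, so that the maximum (and, for continuous \<open>\<phi>\<close>, the real supremum) below is a genuine
  one. The growth rates increase as \<open>\<epsilon>\<close> decreases, so that the limits at \<open>0\<close> exist in
  \<^typ>\<open>ereal\<close>.
\<close>

definition separation_number :: "('a::metric_space \<Rightarrow> 'a) \<Rightarrow> nat \<Rightarrow> real \<Rightarrow> nat" where
  "separation_number f n \<epsilon> = Max {card E | E. separated f n \<epsilon> E}"

definition topological_entropy :: "('a::metric_space \<Rightarrow> 'a) \<Rightarrow> ereal" where
  "topological_entropy f =
     Lim (at_right 0)
       (\<lambda>\<epsilon>. limsup (\<lambda>n. ereal (ln (real (separation_number f n \<epsilon>)) / real n)))"

definition partition_function ::
    "('a::metric_space \<Rightarrow> 'a) \<Rightarrow> ('a \<Rightarrow> real) \<Rightarrow> nat \<Rightarrow> real \<Rightarrow> real" where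
  "partition_function f \<phi> n \<epsilon> =
     Sup {(\<Sum>x\<in>E. exp (birkhoff_sum f \<phi> n x)) | E. separated f n \<epsilon> E}"

definition topological_pressure ::
    "('a::metric_space \<Rightarrow> 'a) \<Rightarrow> ('a \<Rightarrow> real) \<Rightarrow> ereal" where
  "topological_pressure f \<phi> =
     Lim (at_right 0)
       (\<lambda>\<epsilon>. limsup (\<lambda>n. ereal (ln (partition_function f \<phi> n \<epsilon>) / real n)))"


subsection \<open>Invariant measures and metric entropy\<close>

definition borel_prob :: "'a::topological_space measure \<Rightarrow> bool" where
  "borel_prob M \<longleftrightarrow> prob_space M \<and> sets M = sets borel"

definition invariant_prob :: "('a::topological_space \<Rightarrow> 'a) \<Rightarrow> 'a measure \<Rightarrow> bool" where
  "invariant_prob f M \<longleftrightarrow>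
     borel_prob M \<and> f \<in> borel_measurable borel \<and>
     (\<forall>A\<in>sets borel. measure M (f -` A) = measure M A)"

definition non_atomic :: "'a measure \<Rightarrow> bool" where
  "non_atomic M \<longleftrightarrow>
     (\<forall>A\<in>sets M. 0 < emeasure M A \<longrightarrow>
        (\<exists>B\<in>sets M. B \<subseteq> A \<and> 0 < emeasure M B \<and> emeasure M B < emeasure M A))"

definition finite_measurable_partition :: "'a measure \<Rightarrow> 'a set set \<Rightarrow> bool" where
  "finite_measurable_partition M P \<longleftrightarrow> finite P \<and> P \<subseteq> sets M \<and> partition_on (space M) P"

text \<open>
  The join of \<open>P\<close>, \<open>f\<^sup>-\<^sup>1 P\<close>, ..., \<open>f\<^sup>-\<^sup>(\<^sup>n\<^sup>-\<^sup>1\<^sup>) P\<close>; its cells are the nonempty sets of points with a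
  prescribed \<open>P\<close>-itinerary of length \<open>n\<close>.
\<close>

definition dynamical_join :: "('a \<Rightarrow> 'a) \<Rightarrow> nat \<Rightarrow> 'a set set \<Rightarrow> 'a set set" where
  "dynamical_join f n P =
     {(\<Inter>i<n. (f ^^ i) -` c i) | c. \<forall>i<n. c i \<in> P} - {{}}"

definition partition_entropy :: "'a measure \<Rightarrow> 'a set set \<Rightarrow> real" where
  "partition_entropy M P = - (\<Sum>A\<in>P. measure M A * ln (measure M A))"

definition entropy_wrt_partition :: "'a measure \<Rightarrow> ('a \<Rightarrow> 'a) \<Rightarrow> 'a set set \<Rightarrow> real" where
  "entropy_wrt_partition M f P = lim (\<lambda>n. partition_entropy M (dynamical_join f n P) / real n)"

definition metric_entropy :: "'a measure \<Rightarrow> ('a \<Rightarrow> 'a) \<Rightarrow> ereal" where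
  "metric_entropy M f =
     (SUP P\<in>{P. finite_measurable_partition M P}. ereal (entropy_wrt_partition M f P))"


subsection \<open>Equilibrium states and weak-Gibbs measures\<close>

definition measure_pressure :: "'a measure \<Rightarrow> ('a \<Rightarrow> 'a) \<Rightarrow> ('a \<Rightarrow> real) \<Rightarrow> ereal" where
  "measure_pressure M f \<phi> = metric_entropy M f + ereal (integral\<^sup>L M \<phi>)"

definition equilibrium_state ::
    "('a::topological_space \<Rightarrow> 'a) \<Rightarrow> ('a \<Rightarrow> real) \<Rightarrow> 'a measure \<Rightarrow> bool" where
  "equilibrium_state f \<phi> M \<longleftrightarrow>
     invariant_prob f M \<and>
     measure_pressure M f \<phi> = (SUP N\<in>{N. invariant_prob f N}. measure_pressure N f \<phi>)"

text \<open>
  The pressure enters through \<^const>\<open>real_of_ereal\<close>. This is the true value when the topological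
  entropy is finite, since the pressure of a bounded potential is then finite as well.
\<close>

definition weak_gibbs ::
    "('a::metric_space \<Rightarrow> 'a) \<Rightarrow> ('a \<Rightarrow> real) \<Rightarrow> 'a measure \<Rightarrow> bool" where
  "weak_gibbs f \<phi> M \<longleftrightarrow>
     borel_prob M \<and>
     (\<exists>\<epsilon>\<^sub>0>0. \<exists>\<Lambda>\<in>sets M. measure M \<Lambda> = 1 \<and>
       (\<forall>\<epsilon> x. 0 < \<epsilon> \<and> \<epsilon> < \<epsilon>\<^sub>0 \<and> x \<in> \<Lambda> \<longrightarrow>
         (\<exists>\<delta> :: nat \<Rightarrow> real.
            (\<forall>n\<ge>1. 0 < \<delta> n) \<and>
            (\<lambda>n. ln (\<delta> n) / real n) \<longlonglongrightarrow> 0 \<and>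
            (\<forall>n\<ge>1.
               let r = measure M (dynamical_ball f n x \<epsilon>) /
                       exp (- real_of_ereal (topological_pressure f \<phi>) * real n
                            + birkhoff_sum f \<phi> n x)
               in inverse (\<delta> n) \<le> r \<and> r \<le> \<delta> n))))"

end

theory Submission imports Defs begin

text \<open>
  For a partition into cells of diameter less than \<open>\<epsilon>\<close>, the cell of \<open>x\<close> in the \<open>n\<close>-th dynamical
  join lies in the dynamical ball of radius \<open>\<epsilon>\<close>. The upper weak-Gibbs bound therefore makes
  the lower limit of \<open>(- ln \<mu>(cell) + S\<^sub>n \<phi> x) / n\<close> at least the topological pressure almost
  everywhere, and Fatou's lemma turns this into \<open>P\<^sub>t\<^sub>o\<^sub>p \<le> h\<^sub>\<mu> + \<integral>\<phi>\<close>, without the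
  Shannon--McMillan--Breiman theorem. The opposite bound \<open>h\<^sub>\<nu> + \<integral>\<phi> \<le> P\<^sub>t\<^sub>o\<^sub>p\<close> for every
  invariant \<open>\<nu>\<close> is the easy half of the variational principle: the Gibbs inequality gives it up
  to an additive constant, which is removed by passing to the iterates of \<open>f\<close>. Finiteness of the
  entropy makes the pressure a real number.
\<close>

subsection \<open>Subadditive sequences and exponential growth\<close>

lemma subadditive_div_le:
  fixes a :: "nat \<Rightarrow> real"
  assumes subadditive: "\<And>m n. a (m + n) \<le> a m + a n" and m: "0 < m" and n: "0 < n"
  shows "a n / real n \<le> a m / real m + (\<bar>a m\<bar> + (\<Sum>r<m. \<bar>a r\<bar>)) / real n"
proof -
  have multiple: "a (q * m + r) \<le> real q * a m + a r" for q r
  proof (induction q)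
    case (Suc q)
    then show ?case using subadditive[of m "q * m + r"] by (simp add: algebra_simps)
  qed simp
  have "real n = real (n div m) * real m + real (n mod m)"
    by (metis div_mult_mod_eq of_nat_add of_nat_mult)
  then have "real (n div m) * a m = real n / real m * a m - real (n mod m) / real m * a m"
    using m by (simp add: field_simps)
  moreover have "\<bar>real (n mod m) / real m * a m\<bar> \<le> 1 * \<bar>a m\<bar>"
    unfolding abs_mult using m by (intro mult_right_mono) (auto simp: less_imp_le)
  ultimately have "real (n div m) * a m \<le> real n / real m * a m + \<bar>a m\<bar>"
    by linarith
  moreover have "a (n mod m) \<le> (\<Sum>r<m. \<bar>a r\<bar>)"
    using m member_le_sum[of "n mod m" "{..<m}" "\<lambda>r. \<bar>a r\<bar>"] by auto
  ultimately have "a n \<le> real n / real m * a m + (\<bar>a m\<bar> + (\<Sum>r<m. \<bar>a r\<bar>))"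
    using multiple[of "n div m" "n mod m"] by simp
  then show ?thesis using m n by (simp add: field_simps)
qed

lemma subadditive_LIMSEQ_INF:
  fixes a :: "nat \<Rightarrow> real"
  assumes bdd_below: "bdd_below ((\<lambda>n. a n / real n) ` {1..})"
    and subadditive: "\<And>m n. a (m + n) \<le> a m + a n"
  shows "(\<lambda>n. a n / real n) \<longlonglongrightarrow> (INF n\<in>{1..}. a n / real n)"
proof (rule order_tendstoI)
  fix y assume "y < (INF n\<in>{1..}. a n / real n)"
  then show "\<forall>\<^sub>F n in sequentially. y < a n / real n"
    by (intro eventually_sequentiallyI[of 1])
      (auto intro: less_le_trans[OF _ cINF_lower[OF bdd_below]])
next
  fix y assume "(INF n\<in>{1..}. a n / real n) < y"
  then obtain m where m: "1 \<le> m" "a m / real m < y"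
    using bdd_below by (auto simp: cINF_less_iff)
  define K where "K = \<bar>a m\<bar> + (\<Sum>r<m. \<bar>a r\<bar>)"
  have "(\<lambda>n. a m / real m + K / real n) \<longlonglongrightarrow> a m / real m + 0"
    by (intro tendsto_intros lim_const_over_n)
  then have "\<forall>\<^sub>F n in sequentially. a m / real m + K / real n < y"
    using m(2) by (intro order_tendstoD) auto
  then show "\<forall>\<^sub>F n in sequentially. a n / real n < y"
    using eventually_gt_at_top[of 0]
  proof eventually_elim
    case (elim n)
    have "a n / real n \<le> a m / real m + K / real n"
      unfolding K_def using m(1) elim(2) by (intro subadditive_div_le[OF subadditive]) auto
    then show ?case using elim(1) by simp
  qed
qed

definition exponential_growth_rate :: "(nat \<Rightarrow> real) \<Rightarrow> ereal" where
  "exponential_growth_rate a = limsup (\<lambda>n. ereal (ln (a n) / real n))"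

lemma exponential_growth_rate_mono:
  assumes "\<And>n. 0 < a n" "\<And>n. a n \<le> b n"
  shows "exponential_growth_rate a \<le> exponential_growth_rate b"
  unfolding exponential_growth_rate_def
proof (intro Limsup_mono always_eventually allI)
  fix n
  have "ln (a n) \<le> ln (b n)" using assms by (meson ln_mono less_le_trans)
  then show "ereal (ln (a n) / real n) \<le> ereal (ln (b n) / real n)" by (simp add: divide_right_mono)
qed

lemma exponential_growth_rate_exp:
  assumes "(\<lambda>n. b n / real n) \<longlonglongrightarrow> L"
  shows "exponential_growth_rate (\<lambda>n. exp (b n)) = ereal L"
  unfolding exponential_growth_rate_def using assms by (intro lim_imp_Limsup) auto

lemma exponential_growth_rate_mult_exp:
  assumes "\<And>n. 0 < a n"
  shows "exponential_growth_rate (\<lambda>n. a n * exp (real n * c)) = exponential_growth_rate a + ereal c"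
proof -
  have "ln (a n * exp (real n * c)) / real n = ln (a n) / real n + c" if "1 \<le> n" for n
    using that assms[of n] by (simp add: ln_mult add_divide_distrib)
  then have "exponential_growth_rate (\<lambda>n. a n * exp (real n * c))
      = limsup (\<lambda>n. ereal (ln (a n) / real n) + ereal c)"
    unfolding exponential_growth_rate_def by (intro Limsup_eq eventually_sequentiallyI[of 1]) simp
  also have "\<dots> = exponential_growth_rate a + ereal c"
    unfolding exponential_growth_rate_def by (rule Limsup_add_ereal_right) auto
  finally show ?thesis .
qed

lemma exponential_growth_rate_multiples:
  assumes m: "0 < m"
  shows "exponential_growth_rate (\<lambda>n. a (n * m)) \<le> ereal (real m) * exponential_growth_rate a"
proof -
  let ?u = "\<lambda>n. ereal (ln (a n) / real n)"
  have "exponential_growth_rate (\<lambda>n. a (n * m))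
      = limsup (\<lambda>n. ereal (real m) * (?u \<circ> (\<lambda>n. n * m)) n)"
    unfolding exponential_growth_rate_def using m
    by (intro Limsup_eq eventually_sequentiallyI[of 1]) (simp add: field_simps)
  also have "\<dots> = ereal (real m) * limsup (?u \<circ> (\<lambda>n. n * m))"
    by (rule limsup_ereal_mult_left) simp
  also have "\<dots> \<le> ereal (real m) * exponential_growth_rate a"
    unfolding exponential_growth_rate_def using m
    by (intro ereal_mult_left_mono limsup_subseq_mono strict_monoI) auto
  finally show ?thesis .
qed

lemma Lim_at_right_antimono:
  fixes F :: "real \<Rightarrow> 'a::{complete_linorder, linorder_topology}"
  assumes antimono: "\<And>x y. a < x \<Longrightarrow> x \<le> y \<Longrightarrow> F y \<le> F x"
  shows "Lim (at_right a) F = (SUP x\<in>{a<..}. F x)"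
proof (rule tendsto_Lim)
  show "(F \<longlongrightarrow> (SUP x\<in>{a<..}. F x)) (at_right a)"
  proof (rule order_tendstoI)
    fix l assume "l < (SUP x\<in>{a<..}. F x)"
    then obtain y where y: "a < y" "l < F y" by (auto simp: less_SUP_iff)
    have "\<forall>\<^sub>F x in at_right a. a < x \<and> x < y"
      using y(1) by (auto simp: eventually_at_right_field)
    then show "\<forall>\<^sub>F x in at_right a. l < F x"
      by eventually_elim (use antimono y(2) in \<open>meson less_le_trans less_imp_le\<close>)
  next
    fix u assume SUP_less: "(SUP x\<in>{a<..}. F x) < u"
    from eventually_at_right_less show "\<forall>\<^sub>F x in at_right a. F x < u"
      by eventually_elim (use SUP_less in \<open>meson SUP_upper greaterThan_iff le_less_trans\<close>)
  qed
qed simp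

subsection \<open>Entropy of simple functions\<close>

lemma (in prob_space) expectation_simple_function_comp:
  fixes h :: "'b \<Rightarrow> real"
  assumes X: "simple_function M X"
  shows "expectation (\<lambda>x. h (X x)) = (\<Sum>y\<in>X ` space M. prob (X -` {y} \<inter> space M) * h y)"
proof -
  have "distributed M (count_space (X ` space M)) X (\<lambda>y. ennreal (prob (X -` {y} \<inter> space M)))"
    using X by (intro simple_distributed simple_distributedI) auto
  then have "(\<integral>y. prob (X -` {y} \<inter> space M) * h y \<partial>count_space (X ` space M))
      = expectation (\<lambda>x. h (X x))"
    by (intro distributed_integral) auto
  then show ?thesis
    using simple_functionD(1)[OF X] by (simp add: lebesgue_integral_count_space_finite)
qed

lemma (in finite_measure) integrable_simple_function_comp:
  fixes h :: "'b \<Rightarrow> real"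
  assumes "simple_function M X" shows "integrable M (\<lambda>x. h (X x))"
  using simple_function_compose[OF assms, of h]
  by (intro integrable_simple_function) (auto simp: comp_def)

lemma (in prob_space) AE_prob_fibre_pos:
  assumes X: "simple_function M X"
  shows "AE x in M. 0 < prob (X -` {X x} \<inter> space M)"
proof -
  let ?N = "\<Union>y\<in>{y \<in> X ` space M. prob (X -` {y} \<inter> space M) = 0}. X -` {y} \<inter> space M"
  have "?N \<in> null_sets M"
    using simple_functionD[OF X]
    by (intro null_sets_UN' countable_finite) (auto simp: null_sets_def emeasure_eq_measure)
  then show ?thesis by (rule AE_I') (auto simp: zero_less_measure_iff)
qed

lemma simple_function_Collect:
  assumes "finite T" "\<And>t. t \<in> T \<Longrightarrow> A t \<in> sets M"
  shows "simple_function M (\<lambda>x. {t \<in> T. x \<in> A t})"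
  using assms
proof (induction T)
  case (insert t T)
  then have "simple_function M
      (\<lambda>x. if x \<in> A t then insert t {t \<in> T. x \<in> A t} else {t \<in> T. x \<in> A t})"
    by (intro simple_function_If_set simple_function_compose1[where g="insert t"]) auto
  moreover have "{s \<in> insert t T. x \<in> A s}
      = (if x \<in> A t then insert t {t \<in> T. x \<in> A t} else {t \<in> T. x \<in> A t})" for x
    by auto
  ultimately show ?case by simp
qed simp

definition (in information_space) self_information :: "('a \<Rightarrow> 'b) \<Rightarrow> 'a \<Rightarrow> real" where
  "self_information X x = - log b (prob (X -` {X x} \<inter> space M))"

context information_space
begin

lemma self_information_nonneg: "0 \<le> self_information X x"
  unfolding self_information_def
  by (cases "prob (X -` {X x} \<inter> space M) = 0")
    (simp add: log_def, auto simp: b_gt_1 zero_less_measure_iff)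

lemma integrable_self_information:
  assumes "simple_function M X" shows "integrable M (self_information X)"
  unfolding self_information_def by (rule integrable_simple_function_comp[OF assms])

lemma entropy_eq_sum:
  assumes "simple_function M X"
  shows "\<H>(X) = - (\<Sum>y\<in>X ` space M. prob (X -` {y} \<inter> space M) * log b (prob (X -` {y} \<inter> space M)))"
  using assms by (intro entropy_simple_distributed simple_distributedI) auto

lemma entropy_eq_expectation_self_information:
  assumes "simple_function M X"
  shows "\<H>(X) = expectation (self_information X)"
  unfolding self_information_def entropy_eq_sum[OF assms]
  using expectation_simple_function_comp[OF assms, of "\<lambda>y. - log b (prob (X -` {y} \<inter> space M))"]
  by (simp add: sum_negf)

lemma entropy_nonneg:
  assumes "simple_function M X" shows "0 \<le> \<H>(X)"
  unfolding entropy_eq_expectation_self_information[OF assms]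
  by (intro Bochner_Integration.integral_nonneg self_information_nonneg)

lemma entropy_mono:
  assumes Y: "simple_function M Y"
    and refines: "\<And>x y. x \<in> space M \<Longrightarrow> y \<in> space M \<Longrightarrow> Y x = Y y \<Longrightarrow> X x = X y"
  shows "\<H>(X) \<le> \<H>(Y)"
proof -
  define F where "F = X \<circ> inv_into (space M) Y"
  have F: "(F \<circ> Y) x = X x" if "x \<in> space M" for x
    unfolding F_def comp_apply using that by (intro refines inv_into_into f_inv_into_f) auto
  then have "(F \<circ> Y) ` space M = X ` space M" by (rule image_cong[OF refl])
  moreover have "distr M S (F \<circ> Y) = distr M S X" for S :: "'c measure"
    using F by (intro distr_cong) auto
  ultimately have "\<H>(X) = \<H>(F \<circ> Y)" by (simp add: entropy_def)
  also have "\<dots> \<le> \<H>(Y)" by (rule entropy_data_processing[OF Y])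
  finally show ?thesis .
qed

lemma entropy_cong_fibres:
  assumes "simple_function M X" "simple_function M Y"
    and "\<And>x y. x \<in> space M \<Longrightarrow> y \<in> space M \<Longrightarrow> X x = X y \<longleftrightarrow> Y x = Y y"
  shows "\<H>(X) = \<H>(Y)"
  using assms by (intro antisym entropy_mono) auto

lemma entropy_Pair_le:
  assumes "simple_function M X" "simple_function M Y"
  shows "\<H>(\<lambda>x. (X x, Y x)) \<le> \<H>(X) + \<H>(Y)"
  using entropy_chain_rule[OF assms] conditional_entropy_less_eq_entropy[OF assms(2,1)] by simp

lemma gibbs_inequality:
  assumes X: "simple_function M X" and w_pos: "\<And>y. y \<in> X ` space M \<Longrightarrow> 0 < w y"
  shows "\<H>(X) + expectation (\<lambda>x. log b (w (X x))) \<le> log b (\<Sum>y\<in>X ` space M. w y)"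
proof -
  define P where "P y = prob (X -` {y} \<inter> space M)" for y
  define S where "S = {y \<in> X ` space M. 0 < P y}"
  note finite_range = simple_functionD(1)[OF X]
  have S: "finite S" "S \<subseteq> X ` space M" using finite_range by (auto simp: S_def)
  have P_zero: "P y = 0" if "y \<in> X ` space M - S" for y
    using that by (auto simp: S_def P_def zero_less_measure_iff)
  have "simple_distributed M X P" using X by (intro simple_distributedI) (auto simp: P_def)
  then have "sum P S = 1"
    using simple_distributed_sum_space[of X P] P_zero
      sum.mono_neutral_right[OF finite_range S(2), of P] by simp
  then have nonempty: "S \<noteq> {}" by auto
  have "\<H>(X) + expectation (\<lambda>x. log b (w (X x)))
      = (\<Sum>y\<in>X ` space M. P y * (log b (w y) - log b (P y)))"
    unfolding entropy_eq_sum[OF X] P_def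
    using expectation_simple_function_comp[OF X, of "\<lambda>y. log b (w y)"]
    by (simp add: right_diff_distrib sum_subtractf)
  also have "\<dots> = (\<Sum>y\<in>S. P y * (log b (w y) - log b (P y)))"
    using P_zero by (intro sum.mono_neutral_right finite_range S(2)) auto
  also have "\<dots> = (\<Sum>y\<in>S. P y * log b (w y / P y))"
    using w_pos by (intro sum.cong) (auto simp add: S_def log_divide_pos)
  also have "\<dots> \<le> log b (\<Sum>y\<in>S. P y *\<^sub>R (w y / P y))"
    using w_pos \<open>sum P S = 1\<close>
    by (intro concave_on_sum[OF S(1) nonempty log_concave[OF b_gt_1]]) (auto simp: S_def)
  also have "(\<Sum>y\<in>S. P y *\<^sub>R (w y / P y)) = (\<Sum>y\<in>S. w y)"
    by (intro sum.cong) (auto simp: S_def)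
  also have "log b (\<Sum>y\<in>S. w y) \<le> log b (\<Sum>y\<in>X ` space M. w y)"
  proof (subst log_le_cancel_iff[OF b_gt_1])
    show "0 < (\<Sum>y\<in>S. w y)" using S nonempty w_pos by (intro sum_pos) auto
    then show "0 < (\<Sum>y\<in>X ` space M. w y)"
      using nonempty S(2) by (intro sum_pos finite_range w_pos) auto
    show "(\<Sum>y\<in>S. w y) \<le> (\<Sum>y\<in>X ` space M. w y)"
      using w_pos by (intro sum_mono2 finite_range S(2)) (auto intro: less_imp_le)
  qed
  finally show ?thesis .
qed

end

subsection \<open>Itineraries\<close>

definition itinerary :: "('a \<Rightarrow> 'a) \<Rightarrow> nat \<Rightarrow> ('a \<Rightarrow> 'b) \<Rightarrow> 'a \<Rightarrow> nat \<Rightarrow> 'b" where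
  "itinerary f n p x = (\<lambda>i\<in>{..<n}. p ((f ^^ i) x))"

lemma itinerary_eq_iff:
  "itinerary f n p x = itinerary f n p y \<longleftrightarrow> (\<forall>i<n. p ((f ^^ i) x) = p ((f ^^ i) y))"
  by (force simp: itinerary_def restrict_def fun_eq_iff)

lemma itinerary_Suc: "itinerary f (Suc n) p x = (itinerary f n p x)(n := p ((f ^^ n) x))"
  by (auto simp: itinerary_def restrict_def fun_eq_iff)

lemma itinerary_add_eq_iff:
  "itinerary f (m + n) p x = itinerary f (m + n) p y \<longleftrightarrow>
    itinerary f m p x = itinerary f m p y \<and>
    itinerary f n p ((f ^^ m) x) = itinerary f n p ((f ^^ m) y)"
proof -
  have "(\<forall>i<m + n. Q i) \<longleftrightarrow> (\<forall>i<m. Q i) \<and> (\<forall>i<n. Q (i + m))" for Q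
    by (induction n) (auto simp: All_less_Suc add.commute)
  then show ?thesis by (simp add: itinerary_eq_iff funpow_add)
qed

lemma itinerary_funpow_eq_iff:
  "itinerary (f ^^ m) n (itinerary f m p) x = itinerary (f ^^ m) n (itinerary f m p) y \<longleftrightarrow>
    itinerary f (n * m) p x = itinerary f (n * m) p y"
proof (induction n)
  case 0
  show ?case by (simp add: itinerary_def)
next
  case (Suc n)
  have "itinerary (f ^^ m) (Suc n) (itinerary f m p) x
        = itinerary (f ^^ m) (Suc n) (itinerary f m p) y \<longleftrightarrow>
      itinerary (f ^^ m) n (itinerary f m p) x = itinerary (f ^^ m) n (itinerary f m p) y \<and>
      itinerary f m p ((f ^^ (n * m)) x) = itinerary f m p ((f ^^ (n * m)) y)"
    by (auto simp: itinerary_eq_iff[of "f ^^ m"] less_Suc_eq funpow_mult mult.commute)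
  also have "\<dots> \<longleftrightarrow> itinerary f (Suc n * m) p x = itinerary f (Suc n * m) p y"
    unfolding Suc.IH using itinerary_add_eq_iff[of f "n * m" m p x y] by (simp add: add.commute)
  finally show ?case .
qed

definition fibres :: "('a \<Rightarrow> 'b) \<Rightarrow> 'a set set" where
  "fibres p = range (\<lambda>x. p -` {p x})"

lemma fibres_eq_image: "fibres p = (\<lambda>b. p -` {b}) ` range p"
  by (auto simp: fibres_def)

lemma inj_on_vimage_singleton: "inj_on (\<lambda>b. p -` {b}) (range p)"
  by (auto intro!: inj_onI)

lemma partition_on_fibres: "partition_on UNIV (fibres p)"
  by (rule partition_onI) (auto simp: fibres_def disjnt_def)

lemma partition_on_UNIV_eq_fibres:
  assumes P: "partition_on UNIV P"
  obtains p :: "'a \<Rightarrow> 'a set" where "P = fibres p"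
proof -
  have "\<forall>x. \<exists>A. A \<in> P \<and> x \<in> A" using partition_onD1[OF P] by blast
  then obtain p where p: "\<And>x. p x \<in> P" "\<And>x. x \<in> p x" by metis
  have unique: "p x = A" if "A \<in> P" "x \<in> A" for x A
    using disjointD[OF partition_onD2[OF P] p(1)[of x] that(1)] p(2)[of x] that(2) by blast
  have "p -` {p x} = p x" for x
    using unique[OF p(1)] p(2) by auto
  then have "fibres p = range p" by (simp add: fibres_def)
  also have "\<dots> = P"
  proof (intro equalityI subsetI)
    fix A assume "A \<in> P"
    moreover from this obtain x where "x \<in> A" using partition_onD3[OF P] by (cases "A = {}") auto
    ultimately show "A \<in> range p" using unique by blast
  qed (use p(1) in blast)
  finally show ?thesis using that by blast
qed

lemma dynamical_join_fibres: "dynamical_join f n (fibres p) = fibres (itinerary f n p)"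
proof (intro equalityI subsetI)
  fix A assume "A \<in> dynamical_join f n (fibres p)"
  then obtain c z where cells: "\<forall>i<n. c i \<in> fibres p"
    and A_eq: "A = (\<Inter>i<n. (f ^^ i) -` c i)" and z_in: "z \<in> A"
    by (auto simp: dynamical_join_def)
  have "c i = p -` {p ((f ^^ i) z)}" if "i < n" for i
  proof -
    obtain w where "c i = p -` {p w}" using cells \<open>i < n\<close> by (auto simp: fibres_def)
    moreover have "(f ^^ i) z \<in> c i" using z_in \<open>i < n\<close> by (simp add: A_eq)
    ultimately show ?thesis by simp
  qed
  then have "A = itinerary f n p -` {itinerary f n p z}"
    unfolding A_eq by (auto simp: itinerary_eq_iff)
  then show "A \<in> fibres (itinerary f n p)" by (auto simp: fibres_def)
next
  fix A assume "A \<in> fibres (itinerary f n p)"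
  then obtain x where x: "A = itinerary f n p -` {itinerary f n p x}" by (auto simp: fibres_def)
  define c where "c i = p -` {p ((f ^^ i) x)}" for i
  have "A = (\<Inter>i<n. (f ^^ i) -` c i)" "\<forall>i<n. c i \<in> fibres p" "A \<noteq> {}"
    by (auto simp: x c_def itinerary_eq_iff fibres_def)
  then show "A \<in> dynamical_join f n (fibres p)" by (simp add: dynamical_join_def) blast
qed

subsection \<open>Measure-preserving maps\<close>

locale prob_space_UNIV = prob_space M for M :: "'a measure" +
  assumes space_eq_UNIV [simp]: "space M = UNIV"
begin

sublocale information_space M "exp 1" rewrites "log (exp 1) = ln" and "space M = UNIV"
  by unfold_locales (auto simp: log_ln fun_eq_iff)

abbreviation entropy_nat (\<open>\<H>'(_')\<close>) where
  "\<H>(p) \<equiv> entropy (exp 1) (count_space (range p)) p"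

lemma prob_UNIV: "prob UNIV = 1"
  using prob_space by simp

lemma finite_measurable_partition_fibres_iff:
  "finite_measurable_partition M (fibres p) \<longleftrightarrow> simple_function M p"
  using partition_on_fibres[of p]
  by (simp add: finite_measurable_partition_def simple_function_def fibres_eq_image
      finite_image_iff inj_on_vimage_singleton image_subset_iff)

lemma partition_entropy_fibres:
  assumes "simple_function M p"
  shows "partition_entropy M (fibres p) = \<H>(p)"
  by (simp add: partition_entropy_def entropy_eq_sum[OF assms] fibres_eq_image
      sum.reindex inj_on_vimage_singleton)

end

locale measure_preserving_map = prob_space_UNIV M for M :: "'a measure" +
  fixes f :: "'a \<Rightarrow> 'a"
  assumes measurable_map: "f \<in> measurable M M"
    and distr_map: "distr M M f = M"
begin

lemma measure_preserving_map_funpow: "measure_preserving_map M (f ^^ n)"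
proof -
  have "distr M M (f ^^ n) = M"
  proof (induction n)
    case 0
    show ?case by (simp add: id_def)
  next
    case (Suc n)
    have "distr M M (f ^^ Suc n) = distr (distr M M (f ^^ n)) M f"
      using measurable_compose_n[OF measurable_map] measurable_map by (simp add: distr_distr)
    then show ?case unfolding Suc distr_map .
  qed
  then show ?thesis
    using measurable_compose_n[OF measurable_map] by unfold_locales auto
qed

lemma integrable_comp_map:
  fixes h :: "'a \<Rightarrow> real"
  assumes "integrable M h" shows "integrable M (\<lambda>x. h (f x))"
  using integrable_distr[OF measurable_map, of h] assms by (simp add: distr_map)

lemma integral_comp_map:
  fixes h :: "'a \<Rightarrow> real"
  assumes "h \<in> borel_measurable M" shows "(\<integral>x. h (f x) \<partial>M) = (\<integral>x. h x \<partial>M)"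
  using integral_distr[OF measurable_map assms] by (simp add: distr_map)

lemma
  assumes h: "integrable M h"
  shows integrable_birkhoff_sum: "integrable M (birkhoff_sum f h n)"
    and integral_birkhoff_sum: "(\<integral>x. birkhoff_sum f h n x \<partial>M) = real n * (\<integral>x. h x \<partial>M)"
proof -
  note iterate = measure_preserving_map_funpow
  have integrable: "integrable M (\<lambda>x. h ((f ^^ i) x))" for i
    by (rule measure_preserving_map.integrable_comp_map[OF iterate h])
  then show "integrable M (birkhoff_sum f h n)"
    unfolding birkhoff_sum_def by (intro Bochner_Integration.integrable_sum)
  show "(\<integral>x. birkhoff_sum f h n x \<partial>M) = real n * (\<integral>x. h x \<partial>M)"
    unfolding birkhoff_sum_def using h integrable
    by (simp add: Bochner_Integration.integral_sum
        measure_preserving_map.integral_comp_map[OF iterate])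
qed

lemma entropy_comp_map:
  assumes p: "simple_function M p"
  shows "\<H>(\<lambda>x. p (f x)) = \<H>(p)"
proof -
  have "prob ((\<lambda>x. p (f x)) -` {b}) = prob (p -` {b})" for b
  proof -
    have "prob (p -` {b}) = measure (distr M M f) (p -` {b})" by (simp add: distr_map)
    also have "\<dots> = prob (f -` (p -` {b}))"
      using simple_functionD(2)[OF p, of "{b}"] by (subst measure_distr[OF measurable_map]) simp_all
    finally show ?thesis by (simp add: vimage_comp comp_def)
  qed
  then have "self_information (\<lambda>x. p (f x)) = (\<lambda>x. self_information p (f x))"
    by (simp add: self_information_def fun_eq_iff)
  moreover have "expectation (\<lambda>x. self_information p (f x)) = expectation (self_information p)"
    using integrable_self_information[OF p] by (intro integral_comp_map) simp
  ultimately show ?thesis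
    using p simple_function_comp[OF measurable_map p]
    by (simp add: entropy_eq_expectation_self_information)
qed

lemma simple_function_itinerary:
  assumes p: "simple_function M p" shows "simple_function M (itinerary f n p)"
proof (induction n)
  case 0
  show ?case by (simp add: itinerary_def)
next
  case (Suc n)
  have "simple_function M (\<lambda>x. p ((f ^^ n) x))"
    by (rule simple_function_comp[OF measurable_compose_n[OF measurable_map] p])
  from simple_function_compose2[OF Suc this, of "\<lambda>c b. c(n := b)"] show ?case
    by (simp only: itinerary_Suc[abs_def])
qed

definition entropy_rate :: "('a \<Rightarrow> 'b) \<Rightarrow> real" where
  "entropy_rate p = lim (\<lambda>n. \<H>(itinerary f n p) / real n)"

lemma entropy_itinerary_subadditive:
  assumes p: "simple_function M p"
  shows "\<H>(itinerary f (m + n) p) \<le> \<H>(itinerary f m p) + \<H>(itinerary f n p)"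
proof -
  interpret iterate: measure_preserving_map M "f ^^ m" by (rule measure_preserving_map_funpow)
  have shifted: "simple_function M (\<lambda>x. itinerary f n p ((f ^^ m) x))"
    by (rule simple_function_comp[OF iterate.measurable_map simple_function_itinerary[OF p]])
  have "\<H>(itinerary f (m + n) p) = \<H>(\<lambda>x. (itinerary f m p x, itinerary f n p ((f ^^ m) x)))"
    by (intro entropy_cong_fibres simple_function_Pair simple_function_itinerary p shifted)
      (simp add: itinerary_add_eq_iff)
  also have "\<dots> \<le> \<H>(itinerary f m p) + \<H>(\<lambda>x. itinerary f n p ((f ^^ m) x))"
    by (intro entropy_Pair_le simple_function_itinerary p shifted)
  also have "\<H>(\<lambda>x. itinerary f n p ((f ^^ m) x)) = \<H>(itinerary f n p)"
    by (rule iterate.entropy_comp_map[OF simple_function_itinerary[OF p]])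
  finally show ?thesis .
qed

lemma entropy_rate_LIMSEQ:
  assumes p: "simple_function M p"
  shows "(\<lambda>n. \<H>(itinerary f n p) / real n) \<longlonglongrightarrow> entropy_rate p"
proof -
  have "bdd_below ((\<lambda>n. \<H>(itinerary f n p) / real n) ` {1..})"
    using entropy_nonneg[OF simple_function_itinerary[OF p]] by (intro bdd_belowI[of _ 0]) auto
  from subadditive_LIMSEQ_INF[OF this entropy_itinerary_subadditive[OF p]] show ?thesis
    by (simp add: entropy_rate_def limI)
qed

lemma entropy_rate_funpow:
  assumes p: "simple_function M p" and m: "0 < m"
  shows "measure_preserving_map.entropy_rate M (f ^^ m) (itinerary f m p) = real m * entropy_rate p"
proof -
  interpret iterate: measure_preserving_map M "f ^^ m" by (rule measure_preserving_map_funpow)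
  note q = simple_function_itinerary[OF p]
  have "\<H>(itinerary (f ^^ m) n (itinerary f m p)) = \<H>(itinerary f (n * m) p)" for n
    by (intro entropy_cong_fibres iterate.simple_function_itinerary q)
      (rule itinerary_funpow_eq_iff)
  then have "(\<lambda>n. \<H>(itinerary (f ^^ m) n (itinerary f m p)) / real n)
      = (\<lambda>n. real m * (\<H>(itinerary f (n * m) p) / real (n * m)))"
    using m by (simp add: fun_eq_iff)
  also have "\<dots> \<longlonglongrightarrow> real m * entropy_rate p"
    using LIMSEQ_subseq_LIMSEQ[OF entropy_rate_LIMSEQ[OF p], of "\<lambda>n. n * m"] m
    by (intro tendsto_mult_left) (simp add: comp_def strict_mono_def)
  finally show ?thesis
    by (rule LIMSEQ_unique[OF iterate.entropy_rate_LIMSEQ[OF q]])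
qed

lemma entropy_wrt_partition_fibres:
  assumes "simple_function M p"
  shows "entropy_wrt_partition M f (fibres p) = entropy_rate p"
  using assms
  by (simp add: entropy_wrt_partition_def entropy_rate_def dynamical_join_fibres
      partition_entropy_fibres simple_function_itinerary)

lemma entropy_rate_le_metric_entropy:
  assumes "simple_function M p"
  shows "ereal (entropy_rate p) \<le> metric_entropy M f"
  unfolding metric_entropy_def entropy_wrt_partition_fibres[OF assms, symmetric]
  using assms by (intro SUP_upper) (simp add: finite_measurable_partition_fibres_iff)

lemma metric_entropy_least:
  assumes "\<And>p :: 'a \<Rightarrow> 'a set. simple_function M p \<Longrightarrow> ereal (entropy_rate p) \<le> B"
  shows "metric_entropy M f \<le> B"
  unfolding metric_entropy_def
proof (rule SUP_least)
  fix P assume "P \<in> {P. finite_measurable_partition M P}"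
  moreover from this obtain p :: "'a \<Rightarrow> 'a set" where "P = fibres p"
    using partition_on_UNIV_eq_fibres[of P] by (auto simp: finite_measurable_partition_def)
  ultimately have "simple_function M p" "P = fibres p"
    by (auto simp: finite_measurable_partition_fibres_iff)
  then show "ereal (entropy_wrt_partition M f P) \<le> B"
    using assms by (simp add: entropy_wrt_partition_fibres)
qed

end

subsection \<open>Topological pressure\<close>

definition spanning :: "('a::metric_space \<Rightarrow> 'a) \<Rightarrow> nat \<Rightarrow> real \<Rightarrow> 'a set \<Rightarrow> bool" where
  "spanning f n \<epsilon> E \<longleftrightarrow> (\<forall>x. \<exists>y\<in>E. \<forall>i<n. dist ((f ^^ i) x) ((f ^^ i) y) \<le> \<epsilon>)"

lemma separated_singleton: "separated f n \<epsilon> {x}"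
  by (simp add: separated_def)

lemma separated_antimono: "separated f n \<epsilon>' E \<Longrightarrow> \<epsilon> \<le> \<epsilon>' \<Longrightarrow> separated f n \<epsilon> E"
  unfolding separated_def by (meson le_less_trans)

lemma separated_funpow:
  assumes "0 < m" "separated (f ^^ m) n \<epsilon> E"
  shows "separated f (n * m) \<epsilon> E"
proof -
  have "\<exists>j<n * m. \<epsilon> < dist ((f ^^ j) x) ((f ^^ j) y)" if "x \<in> E" "y \<in> E" "x \<noteq> y" for x y
  proof -
    obtain i where "i < n" "\<epsilon> < dist (((f ^^ m) ^^ i) x) (((f ^^ m) ^^ i) y)"
      using assms(2) \<open>x \<in> E\<close> \<open>y \<in> E\<close> \<open>x \<noteq> y\<close> by (auto simp: separated_def)
    then show ?thesis
      using assms(1) by (intro exI[of _ "i * m"]) (simp add: funpow_mult mult.commute)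
  qed
  then show ?thesis using assms(2) by (simp add: separated_def)
qed

lemma birkhoff_sum_add:
  "birkhoff_sum f \<phi> (m + n) x = birkhoff_sum f \<phi> m x + birkhoff_sum f \<phi> n ((f ^^ m) x)"
  by (induction n) (simp_all add: birkhoff_sum_def funpow_add add.commute[of m] algebra_simps)

lemma birkhoff_sum_funpow:
  "birkhoff_sum (f ^^ m) (birkhoff_sum f \<phi> m) n x = birkhoff_sum f \<phi> (n * m) x"
proof (induction n)
  case (Suc n)
  have "birkhoff_sum (f ^^ m) (birkhoff_sum f \<phi> m) (Suc n) x
      = birkhoff_sum f \<phi> (n * m) x + birkhoff_sum f \<phi> m ((f ^^ (n * m)) x)"
    using Suc by (simp add: birkhoff_sum_def funpow_mult mult.commute)
  then show ?case
    using birkhoff_sum_add[of f \<phi> "n * m" m x] by (simp add: add.commute)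
qed (simp add: birkhoff_sum_def)

lemma birkhoff_sum_mono:
  assumes "\<And>x. \<phi> x \<le> \<psi> x" shows "birkhoff_sum f \<phi> n x \<le> birkhoff_sum f \<psi> n x"
  unfolding birkhoff_sum_def by (intro sum_mono assms)

lemma birkhoff_sum_add_const: "birkhoff_sum f (\<lambda>x. \<phi> x + c) n x = birkhoff_sum f \<phi> n x + real n * c"
  by (simp add: birkhoff_sum_def sum.distrib)

lemma abs_birkhoff_sum_le:
  assumes "\<And>x. \<bar>\<phi> x\<bar> \<le> C"
  shows "\<bar>birkhoff_sum f \<phi> n x\<bar> \<le> real n * C"
proof -
  have "\<bar>birkhoff_sum f \<phi> n x\<bar> \<le> (\<Sum>i<n. \<bar>\<phi> ((f ^^ i) x)\<bar>)"
    unfolding birkhoff_sum_def by (rule sum_abs)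
  also have "\<dots> \<le> (\<Sum>i<n. C)" by (intro sum_mono assms)
  finally show ?thesis by simp
qed

lemma bounded_birkhoff_sum:
  assumes "bounded (range \<phi>)" shows "bounded (range (birkhoff_sum f \<phi> n))"
proof -
  obtain C where "\<And>x. \<bar>\<phi> x\<bar> \<le> C" using assms by (auto simp: bounded_iff)
  then show ?thesis unfolding bounded_iff using abs_birkhoff_sum_le by (metis rangeE real_norm_def)
qed

lemma partition_function_least:
  assumes "\<And>E. separated f n \<epsilon> E \<Longrightarrow> (\<Sum>x\<in>E. exp (birkhoff_sum f \<phi> n x)) \<le> B"
  shows "partition_function f \<phi> n \<epsilon> \<le> B"
  unfolding partition_function_def using separated_singleton assms by (intro cSup_least) blast+

locale compact_dynamics =
  fixes f :: "'a::metric_space \<Rightarrow> 'a"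
  assumes compact_UNIV: "compact (UNIV :: 'a set)"
    and continuous_map: "continuous_on UNIV f"
begin

lemma continuous_on_funpow: "continuous_on UNIV (f ^^ n)"
proof (induction n)
  case (Suc n)
  then show ?case
    using continuous_on_compose[OF Suc continuous_on_subset[OF continuous_map subset_UNIV]] by simp
qed (simp add: id_def)

lemma compact_dynamics_funpow: "compact_dynamics (f ^^ n)"
  using compact_UNIV continuous_on_funpow by unfold_locales

lemma bounded_range_continuous:
  fixes \<phi> :: "'a \<Rightarrow> 'b::metric_space"
  assumes "continuous_on UNIV \<phi>" shows "bounded (range \<phi>)"
  using compact_continuous_image[OF assms compact_UNIV] by (rule compact_imp_bounded)

lemma continuous_on_birkhoff_sum:
  assumes "continuous_on UNIV \<phi>" shows "continuous_on UNIV (birkhoff_sum f \<phi> n)"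
  unfolding birkhoff_sum_def
  by (intro continuous_on_sum continuous_on_compose2[OF assms] continuous_on_funpow) auto

lemma open_dynamical_ball: "open (dynamical_ball f n x \<epsilon>)"
proof -
  have "dynamical_ball f n x \<epsilon> = (\<Inter>i<n. (f ^^ i) -` ball ((f ^^ i) x) \<epsilon>)"
    by (auto simp: dynamical_ball_def)
  then show ?thesis using continuous_on_funpow by (auto intro!: open_INT open_vimage)
qed

lemma card_separated_bounded:
  assumes \<epsilon>: "0 < \<epsilon>"
  obtains N where "\<And>E. separated f n \<epsilon> E \<Longrightarrow> card E \<le> N"
proof -
  have "UNIV \<subseteq> (\<Union>x\<in>UNIV. dynamical_ball f n x (\<epsilon> / 2))"
    using \<epsilon> by (auto simp: dynamical_ball_def intro!: exI)
  then obtain T where T: "finite T" "UNIV \<subseteq> (\<Union>x\<in>T. dynamical_ball f n x (\<epsilon> / 2))"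
    using compactE_image[OF compact_UNIV] open_dynamical_ball by metis
  from T(2) have "\<forall>x. \<exists>y. y \<in> T \<and> x \<in> dynamical_ball f n y (\<epsilon> / 2)" by blast
  from choice[OF this] obtain c
    where centre: "\<And>x. c x \<in> T" "\<And>x. x \<in> dynamical_ball f n (c x) (\<epsilon> / 2)" by blast
  have "card E \<le> card T" if E: "separated f n \<epsilon> E" for E
  proof -
    have "inj_on c E"
    proof (rule inj_onI, rule ccontr)
      fix x y assume xy: "x \<in> E" "y \<in> E" "c x = c y" "x \<noteq> y"
      then obtain i where i: "i < n" "\<epsilon> < dist ((f ^^ i) x) ((f ^^ i) y)"
        using E by (auto simp: separated_def)
      have "dist ((f ^^ i) (c x)) ((f ^^ i) x) < \<epsilon> / 2" "dist ((f ^^ i) (c x)) ((f ^^ i) y) < \<epsilon> / 2"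
        using centre(2)[of x] centre(2)[of y] xy(3) i(1) by (simp_all add: dynamical_ball_def)
      from dist_triangle_half_r[OF this] i(2) show False by simp
    qed
    then show ?thesis using centre(1) T(1) by (intro card_inj_on_le[of c]) auto
  qed
  then show ?thesis using that by blast
qed

lemma separated_spanning_exists:
  assumes \<epsilon>: "0 < \<epsilon>"
  obtains E where "separated f n \<epsilon> E" "spanning f n \<epsilon> E"
proof -
  obtain N where card_le: "\<And>E. separated f n \<epsilon> E \<Longrightarrow> card E \<le> N"
    using card_separated_bounded[OF \<epsilon>] by blast
  obtain E where max_card: "separated f n \<epsilon> E" "\<And>F. separated f n \<epsilon> F \<Longrightarrow> card F \<le> card E"
    using ex_has_greatest_nat[of "separated f n \<epsilon>" "{undefined}" card "Suc N"] card_le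
    by (auto simp: separated_singleton less_Suc_eq_le)
  have "\<exists>y\<in>E. \<forall>i<n. dist ((f ^^ i) x) ((f ^^ i) y) \<le> \<epsilon>" for x
  proof (rule ccontr)
    assume "\<not> ?thesis"
    then have far: "\<exists>i<n. \<epsilon> < dist ((f ^^ i) x) ((f ^^ i) y)" if "y \<in> E" for y
      using that by (meson not_le)
    then have "x \<notin> E" using \<epsilon> by fastforce
    have "separated f n \<epsilon> (insert x E)"
      using max_card(1) far by (auto simp: separated_def dist_commute)
    from max_card(2)[OF this] show False using max_card(1) \<open>x \<notin> E\<close>
      by (simp add: separated_def)
  qed
  then show ?thesis using that[OF max_card(1)] by (simp add: spanning_def)
qed

lemma bdd_above_partition_sums:
  assumes \<epsilon>: "0 < \<epsilon>" and \<phi>: "bounded (range \<phi>)"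
  shows "bdd_above {(\<Sum>x\<in>E. exp (birkhoff_sum f \<phi> n x)) | E. separated f n \<epsilon> E}"
proof -
  obtain N where card_le: "\<And>E. separated f n \<epsilon> E \<Longrightarrow> card E \<le> N"
    using card_separated_bounded[OF \<epsilon>] by blast
  obtain C where sum_le: "\<And>x. birkhoff_sum f \<phi> n x \<le> C"
    using bounded_birkhoff_sum[OF \<phi>] by (force simp: bounded_iff abs_le_iff)
  have "(\<Sum>x\<in>E. exp (birkhoff_sum f \<phi> n x)) \<le> real N * exp C" if E: "separated f n \<epsilon> E" for E
  proof -
    have "(\<Sum>x\<in>E. exp (birkhoff_sum f \<phi> n x)) \<le> real (card E) * exp C"
      using sum_le by (intro sum_bounded_above) simp
    also have "\<dots> \<le> real N * exp C" using card_le[OF E] by simp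
    finally show ?thesis .
  qed
  then show ?thesis by (intro bdd_aboveI[of _ "real N * exp C"]) auto
qed

lemma partition_function_upper:
  assumes "0 < \<epsilon>" "bounded (range \<phi>)" "separated f n \<epsilon> E"
  shows "(\<Sum>x\<in>E. exp (birkhoff_sum f \<phi> n x)) \<le> partition_function f \<phi> n \<epsilon>"
  unfolding partition_function_def using assms
  by (intro cSup_upper bdd_above_partition_sums) auto

lemma partition_function_pos:
  assumes "0 < \<epsilon>" "bounded (range \<phi>)"
  shows "0 < partition_function f \<phi> n \<epsilon>"
  using partition_function_upper[OF assms separated_singleton] less_le_trans[OF exp_gt_zero]
  by simp metis

lemma partition_function_antimono:
  assumes "0 < \<epsilon>" "\<epsilon> \<le> \<epsilon>'" "bounded (range \<phi>)"
  shows "partition_function f \<phi> n \<epsilon>' \<le> partition_function f \<phi> n \<epsilon>"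
  using assms separated_antimono by (intro partition_function_least partition_function_upper) blast+

lemma partition_function_le_mult_exp:
  assumes \<epsilon>: "0 < \<epsilon>" and \<psi>: "bounded (range \<psi>)" and potential_le: "\<And>x. \<phi> x \<le> \<psi> x + c"
  shows "partition_function f \<phi> n \<epsilon> \<le> partition_function f \<psi> n \<epsilon> * exp (real n * c)"
proof (rule partition_function_least)
  fix E assume E: "separated f n \<epsilon> E"
  have "(\<Sum>x\<in>E. exp (birkhoff_sum f \<phi> n x)) \<le> (\<Sum>x\<in>E. exp (birkhoff_sum f \<psi> n x) * exp (real n * c))"
    unfolding exp_add[symmetric] birkhoff_sum_add_const[symmetric]
    by (intro sum_mono) (simp add: birkhoff_sum_mono potential_le)
  also have "\<dots> \<le> partition_function f \<psi> n \<epsilon> * exp (real n * c)"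
    unfolding sum_distrib_right[symmetric]
    by (intro mult_right_mono partition_function_upper[OF \<epsilon> \<psi> E]) simp
  finally show "(\<Sum>x\<in>E. exp (birkhoff_sum f \<phi> n x))
    \<le> partition_function f \<psi> n \<epsilon> * exp (real n * c)" .
qed

lemma partition_function_funpow_le:
  assumes "0 < \<epsilon>" "bounded (range \<phi>)" "0 < m"
  shows "partition_function (f ^^ m) (birkhoff_sum f \<phi> m) n \<epsilon> \<le> partition_function f \<phi> (n * m) \<epsilon>"
  unfolding birkhoff_sum_funpow using assms
  by (intro partition_function_least)
    (auto simp: birkhoff_sum_funpow intro: partition_function_upper separated_funpow)

lemma topological_pressure_eq_SUP:
  assumes "bounded (range \<phi>)"
  shows "topological_pressure f \<phi>
    = (SUP \<epsilon>\<in>{0<..}. exponential_growth_rate (\<lambda>n. partition_function f \<phi> n \<epsilon>))"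
  unfolding topological_pressure_def exponential_growth_rate_def[symmetric] using assms
  by (intro Lim_at_right_antimono exponential_growth_rate_mono partition_function_pos
      partition_function_antimono) auto

lemma topological_pressure_upper:
  assumes "0 < \<epsilon>" "bounded (range \<phi>)"
  shows "exponential_growth_rate (\<lambda>n. partition_function f \<phi> n \<epsilon>) \<le> topological_pressure f \<phi>"
  unfolding topological_pressure_eq_SUP[OF assms(2)] using assms(1) by (intro SUP_upper) simp

lemma topological_pressure_le_add:
  assumes \<phi>: "bounded (range \<phi>)" and \<psi>: "bounded (range \<psi>)" and potential_le: "\<And>x. \<phi> x \<le> \<psi> x + c"
  shows "topological_pressure f \<phi> \<le> topological_pressure f \<psi> + ereal c"
  unfolding topological_pressure_eq_SUP[OF \<phi>]
proof (rule SUP_least)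
  fix \<epsilon> :: real assume "\<epsilon> \<in> {0<..}"
  then have \<epsilon>: "0 < \<epsilon>" by simp
  have "exponential_growth_rate (\<lambda>n. partition_function f \<phi> n \<epsilon>)
      \<le> exponential_growth_rate (\<lambda>n. partition_function f \<psi> n \<epsilon> * exp (real n * c))"
    by (intro exponential_growth_rate_mono partition_function_pos
        partition_function_le_mult_exp \<epsilon> \<phi> \<psi> potential_le)
  also have "\<dots> = exponential_growth_rate (\<lambda>n. partition_function f \<psi> n \<epsilon>) + ereal c"
    by (intro exponential_growth_rate_mult_exp partition_function_pos \<epsilon> \<psi>)
  also have "\<dots> \<le> topological_pressure f \<psi> + ereal c"
    by (intro add_right_mono topological_pressure_upper \<epsilon> \<psi>)
  finally show "exponential_growth_rate (\<lambda>n. partition_function f \<phi> n \<epsilon>)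
    \<le> topological_pressure f \<psi> + ereal c" .
qed

lemma topological_pressure_funpow_le:
  assumes \<phi>: "bounded (range \<phi>)" and m: "0 < m"
  shows "topological_pressure (f ^^ m) (birkhoff_sum f \<phi> m)
    \<le> ereal (real m) * topological_pressure f \<phi>"
proof -
  interpret iterate: compact_dynamics "f ^^ m" by (rule compact_dynamics_funpow)
  note bounded_sum = bounded_birkhoff_sum[OF \<phi>, of f m]
  show ?thesis
    unfolding iterate.topological_pressure_eq_SUP[OF bounded_sum]
  proof (rule SUP_least)
    fix \<epsilon> :: real assume "\<epsilon> \<in> {0<..}"
    then have \<epsilon>: "0 < \<epsilon>" by simp
    have "exponential_growth_rate (\<lambda>n. partition_function (f ^^ m) (birkhoff_sum f \<phi> m) n \<epsilon>)
        \<le> exponential_growth_rate (\<lambda>n. partition_function f \<phi> (n * m) \<epsilon>)"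
      by (intro exponential_growth_rate_mono iterate.partition_function_pos
          partition_function_funpow_le \<epsilon> \<phi> bounded_sum m)
    also have "\<dots> \<le> ereal (real m) * exponential_growth_rate (\<lambda>n. partition_function f \<phi> n \<epsilon>)"
      by (rule exponential_growth_rate_multiples[OF m])
    also have "\<dots> \<le> ereal (real m) * topological_pressure f \<phi>"
      by (intro ereal_mult_left_mono topological_pressure_upper \<epsilon> \<phi>) simp
    finally show "exponential_growth_rate (\<lambda>n. partition_function (f ^^ m) (birkhoff_sum f \<phi> m) n \<epsilon>)
      \<le> ereal (real m) * topological_pressure f \<phi>" .
  qed
qed

lemma partition_function_zero:
  assumes \<epsilon>: "0 < \<epsilon>"
  shows "partition_function f (\<lambda>_. 0) n \<epsilon> = real (separation_number f n \<epsilon>)"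
proof -
  let ?cards = "card ` {E. separated f n \<epsilon> E}"
  obtain N where card_le: "\<And>E. separated f n \<epsilon> E \<Longrightarrow> card E \<le> N"
    using card_separated_bounded[OF \<epsilon>, of n] by blast
  have finite_cards: "finite ?cards"
    by (rule finite_subset[of _ "{..N}"]) (auto dest: card_le)
  have nonempty: "?cards \<noteq> {}" using separated_singleton[of f n \<epsilon>] by auto
  have "partition_function f (\<lambda>_. 0) n \<epsilon> = Sup (real ` ?cards)"
    by (simp add: partition_function_def birkhoff_sum_def setcompr_eq_image image_image)
  also have "\<dots> = Max (real ` ?cards)"
    using finite_cards nonempty by (intro cSup_eq_Max) auto
  also have "\<dots> = real (Max ?cards)"
    using finite_cards nonempty by (intro mono_Max_commute[symmetric] monoI) auto
  finally show ?thesis by (simp add: separation_number_def setcompr_eq_image)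
qed

lemma topological_pressure_zero: "topological_pressure f (\<lambda>_. 0) = topological_entropy f"
  unfolding topological_pressure_def topological_entropy_def
  by (intro Lim_cong eventually_mono[OF eventually_at_right_less])
    (simp_all add: partition_function_zero)

lemma topological_entropy_nonneg: "0 \<le> topological_entropy f"
proof -
  have "1 \<le> partition_function f (\<lambda>_. 0) n 1" for n
    using partition_function_upper[OF zero_less_one _ separated_singleton, of "\<lambda>_. 0" n]
    by (simp add: birkhoff_sum_def)
  then have "exponential_growth_rate (\<lambda>n. exp 0)
      \<le> exponential_growth_rate (\<lambda>n. partition_function f (\<lambda>_. 0) n 1)"
    by (intro exponential_growth_rate_mono) auto
  also have "\<dots> \<le> topological_pressure f (\<lambda>_. 0)" by (rule topological_pressure_upper) auto
  finally show ?thesis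
    using exponential_growth_rate_exp[of "\<lambda>_. 0" 0]
    by (simp add: topological_pressure_zero zero_ereal_def)
qed

lemma topological_pressure_finite:
  assumes \<phi>: "bounded (range \<phi>)" and entropy_finite: "topological_entropy f < \<infinity>"
  shows "\<bar>topological_pressure f \<phi>\<bar> \<noteq> \<infinity>"
proof -
  obtain C where abs_le: "\<And>x. \<bar>\<phi> x\<bar> \<le> C" using \<phi> by (auto simp: bounded_iff)
  have bounded_zero: "bounded (range (\<lambda>_ :: 'a. 0 :: real))" by simp
  have potential_le: "\<phi> x \<le> 0 + C" "0 \<le> \<phi> x + C" for x using abs_le[of x] by auto
  have "topological_pressure f \<phi> \<le> topological_entropy f + ereal C"
    using topological_pressure_le_add[OF \<phi> bounded_zero potential_le(1)]
    by (simp add: topological_pressure_zero)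
  moreover have "topological_entropy f \<le> topological_pressure f \<phi> + ereal C"
    using topological_pressure_le_add[OF bounded_zero \<phi> potential_le(2)]
    by (simp add: topological_pressure_zero)
  ultimately show ?thesis
    using entropy_finite topological_entropy_nonneg by (cases "topological_pressure f \<phi>") auto
qed

end

subsection \<open>Regularity of finite Borel measures\<close>

lemma (in finite_measure) measure_decseq_less:
  assumes "range G \<subseteq> sets M" "decseq G" "measure M (\<Inter>n. G n) < e"
  obtains n :: nat where "measure M (G n) < e"
proof -
  have "(\<lambda>n. measure M (G n)) \<longlonglongrightarrow> measure M (\<Inter>n. G n)"
    by (rule finite_Lim_measure_decseq[OF assms(1,2)])
  then have "\<forall>\<^sub>F n in sequentially. measure M (G n) < e" using assms(3) by (rule order_tendstoD)
  then show ?thesis using that by (auto dest: eventually_happens)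
qed

definition closed_open_approximable :: "'a::topological_space measure \<Rightarrow> 'a set \<Rightarrow> bool" where
  "closed_open_approximable M A \<longleftrightarrow>
    (\<forall>e>0. \<exists>F U. closed F \<and> open U \<and> F \<subseteq> A \<and> A \<subseteq> U \<and> measure M (U - F) < e)"

lemma closed_open_approximableE:
  assumes "closed_open_approximable M A" "0 < e"
  obtains F U where "closed F" "open U" "F \<subseteq> A" "A \<subseteq> U" "measure M (U - F) < e"
  using assms by (auto simp: closed_open_approximable_def)

lemma closed_open_approximable_Compl:
  assumes "closed_open_approximable M A" shows "closed_open_approximable M (- A)"
  unfolding closed_open_approximable_def
proof (intro allI impI)
  fix e :: real assume "0 < e"
  then obtain F U where "closed F" "open U" "F \<subseteq> A" "A \<subseteq> U" "measure M (U - F) < e"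
    using closed_open_approximableE[OF assms] by blast
  moreover have "- F - - U = U - F" by blast
  ultimately show "\<exists>F U. closed F \<and> open U \<and> F \<subseteq> - A \<and> - A \<subseteq> U \<and> measure M (U - F) < e"
    by (intro exI[of _ "- U"] exI[of _ "- F"]) auto
qed

locale metric_finite_measure = finite_measure M for M :: "'a::metric_space measure" +
  assumes sets_eq_borel: "sets M = sets borel"
begin

lemma space_borel_eq_UNIV: "space M = UNIV"
  using sets_eq_imp_space_eq[OF sets_eq_borel] by simp

lemma closed_open_approximable_open:
  assumes S: "open S" shows "closed_open_approximable M S"
  unfolding closed_open_approximable_def
proof (intro allI impI)
  fix e :: real assume e: "0 < e"
  have "fsigma_in euclidean S"
    using S by (intro open_imp_fsigma_in metrizable_space_euclidean) simp
  then obtain C where closed_exhaustion: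
    "\<And>n. closed (C n)" "\<And>n. C n \<subseteq> C (Suc n)" "\<Union> (range C) = S"
    by (auto simp: fsigma_in_ascending)
  have "range (\<lambda>n. S - C n) \<subseteq> sets M"
    using S closed_exhaustion(1) by (auto simp: sets_eq_borel)
  moreover have "decseq (\<lambda>n. S - C n)" using closed_exhaustion(2) by (intro decseq_SucI) auto
  moreover have "(\<Inter>n. S - C n) = {}" using closed_exhaustion(3) by blast
  with e have "measure M (\<Inter>n. S - C n) < e" by (simp only: measure_empty)
  ultimately obtain n where "measure M (S - C n) < e" by (rule measure_decseq_less)
  then show "\<exists>F U. closed F \<and> open U \<and> F \<subseteq> S \<and> S \<subseteq> U \<and> measure M (U - F) < e"
    using S closed_exhaustion by (intro exI[of _ "C n"] exI[of _ S]) auto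
qed

lemma closed_open_approximable_UN:
  fixes A :: "nat \<Rightarrow> 'a set"
  assumes A: "\<And>i. closed_open_approximable M (A i)"
  shows "closed_open_approximable M (\<Union>i. A i)"
  unfolding closed_open_approximable_def
proof (intro allI impI)
  fix e :: real assume e: "0 < e"
  let ?\<eta> = "\<lambda>i. e / 2 * (1 / 2) ^ Suc i"
  have "\<exists>F U. closed F \<and> open U \<and> F \<subseteq> A i \<and> A i \<subseteq> U \<and> measure M (U - F) < ?\<eta> i" for i
  proof -
    have "0 < ?\<eta> i" using e by simp
    then show ?thesis using A[of i] unfolding closed_open_approximable_def by blast
  qed
  then obtain F U where FU: "\<And>i. closed (F i)" "\<And>i. open (U i)" "\<And>i. F i \<subseteq> A i" "\<And>i. A i \<subseteq> U i"
    "\<And>i. measure M (U i - F i) < ?\<eta> i" by metis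
  have sets: "U i \<in> sets M" "F i \<in> sets M" for i using FU(1,2) by (auto simp: sets_eq_borel)
  have sums: "?\<eta> sums (e / 2 * 1)" by (intro sums_mult power_half_series)
  have measure_le: "norm (measure M (U i - F i)) \<le> ?\<eta> i" for i
    using FU(5)[of i] by simp
  note summable = summable_comparison_test'[OF sums_summable[OF sums] measure_le]
  define G where "G n = (\<Union>i. U i) - (\<Union>i<n. F i)" for n
  have "measure M (\<Inter>n. G n) \<le> measure M (\<Union>i. U i - F i)"
  proof (rule finite_measure_mono)
    show "(\<Inter>n. G n) \<subseteq> (\<Union>i. U i - F i)" by (fastforce simp: G_def)
  qed (use sets in auto)
  also have "\<dots> \<le> (\<Sum>i. measure M (U i - F i))"
    using sets by (intro finite_measure_subadditive_countably summable) auto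
  also have "\<dots> \<le> (\<Sum>i. ?\<eta> i)"
    using measure_le by (intro suminf_le summable sums_summable[OF sums]) simp
  also have "\<dots> < e" using sums_unique[OF sums] e by simp
  finally have "measure M (\<Inter>n. G n) < e" .
  moreover have "decseq G" by (rule decseq_SucI) (auto simp: G_def)
  moreover have "range G \<subseteq> sets M" using sets by (auto simp: G_def)
  ultimately obtain n where "measure M (G n) < e" using measure_decseq_less by blast
  moreover have "closed (\<Union>i<n. F i)" "open (\<Union>i. U i)" using FU(1,2) by auto
  moreover have "(\<Union>i<n. F i) \<subseteq> (\<Union>i. A i)" "(\<Union>i. A i) \<subseteq> (\<Union>i. U i)" using FU(3,4) by blast+
  ultimately show "\<exists>F U. closed F \<and> open U \<and> F \<subseteq> (\<Union>i. A i) \<and> (\<Union>i. A i) \<subseteq> U \<and> measure M (U - F) < e"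
    unfolding G_def by blast
qed

lemma closed_open_approximable_borel:
  assumes "A \<in> sets borel" shows "closed_open_approximable M A"
proof -
  have "A \<in> sigma_sets UNIV {S. open S}" using assms by (simp add: borel_def)
  then show ?thesis
  proof induction
    case (Compl A)
    then show ?case using closed_open_approximable_Compl by (simp add: Compl_eq_Diff_UNIV)
  qed (simp_all add: closed_open_approximable_open closed_open_approximable_UN)
qed

lemma simple_function_closed_cores:
  assumes p: "simple_function M p" and e: "0 < e"
  obtains B where "\<And>b. closed (B b)" "\<And>b. B b \<subseteq> p -` {b}" "measure M {x. x \<notin> B (p x)} < e"
proof -
  note [simp] = space_borel_eq_UNIV
  have finite_range: "finite (range p)" using simple_functionD(1)[OF p] by simp
  have fibre: "p -` {b} \<in> sets M" for b using simple_functionD(2)[OF p, of "{b}"] by simp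
  define \<eta> where "\<eta> = e / card (range p)"
  have \<eta>: "0 < \<eta>" using e finite_range by (simp add: \<eta>_def card_gt_0_iff)
  have "\<exists>F. closed F \<and> F \<subseteq> p -` {b} \<and> measure M (p -` {b} - F) < \<eta>" for b
  proof -
    obtain F U where FU: "closed F" "open U" "F \<subseteq> p -` {b}" "p -` {b} \<subseteq> U" "measure M (U - F) < \<eta>"
      using closed_open_approximableE[OF closed_open_approximable_borel \<eta>] fibre sets_eq_borel
      by metis
    have "measure M (p -` {b} - F) \<le> measure M (U - F)"
      using FU(1,2,4) by (intro finite_measure_mono) (auto simp: sets_eq_borel)
    then show ?thesis using FU by (intro exI[of _ F]) simp
  qed
  then obtain B where B: "\<And>b. closed (B b)" "\<And>b. B b \<subseteq> p -` {b}"
    "\<And>b. measure M (p -` {b} - B b) < \<eta>"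
    by metis
  have "measure M {x. x \<notin> B (p x)} = measure M (\<Union>b\<in>range p. p -` {b} - B b)"
    by (rule arg_cong[where f="measure M"]) auto
  also have "\<dots> \<le> (\<Sum>b\<in>range p. measure M (p -` {b} - B b))"
    using finite_range fibre B(1)
    by (intro finite_measure_subadditive_finite) (auto simp: sets_eq_borel)
  also have "\<dots> < (\<Sum>b\<in>range p. \<eta>)" using finite_range B(3) by (intro sum_strict_mono) auto
  also have "\<dots> = e" using finite_range by (simp add: \<eta>_def)
  finally show ?thesis using that B by blast
qed

end

lemma compact_disjoint_closed_ball_meets_one:
  fixes B :: "'i \<Rightarrow> 'a::metric_space set"
  assumes compact: "compact (UNIV :: 'a set)" and I: "finite I"
    and B: "\<And>i. i \<in> I \<Longrightarrow> closed (B i)" "disjoint_family_on B I"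
  obtains e where "0 < e" "\<And>y. \<exists>j. \<forall>i\<in>I. ball y e \<inter> B i \<noteq> {} \<longrightarrow> i = j"
proof -
  let ?G = "\<lambda>j. - (\<Union>i\<in>I - {j}. B i)"
  have cover: "(UNIV :: 'a set) \<subseteq> \<Union> (range ?G)"
  proof
    fix x
    obtain j where "\<And>i. i \<in> I \<Longrightarrow> x \<in> B i \<Longrightarrow> i = j"
      using B(2) by (metis disjoint_family_onD disjoint_iff)
    then show "x \<in> \<Union> (range ?G)" by blast
  qed
  have "open G" if "G \<in> range ?G" for G
    using that B(1) I by (auto intro!: closed_UN)
  then obtain e where e: "0 < e" "\<And>y. \<exists>G\<in>range ?G. ball y e \<subseteq> G"
    using Heine_Borel_lemma[OF compact cover] by (metis UNIV_I)
  have "\<exists>j. \<forall>i\<in>I. ball y e \<inter> B i \<noteq> {} \<longrightarrow> i = j" for y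
    using e(2)[of y] by fastforce
  then show ?thesis using that e(1) by blast
qed

subsection \<open>Weighted counting of itineraries\<close>

text \<open>
  Each fibre of \<open>p\<close> consists of a closed core and a remainder. A small ball meets at most one core,
  and the labels of the remainders carry total weight \<open>1\<close>; so the labels occurring in a small ball
  weigh at most \<open>2\<close>, although their number may grow with the range of \<open>p\<close>. The Gibbs
  inequality with the product weights of itineraries replaces the conditional entropy estimates of
  the classical argument.
\<close>

definition core_label :: "('a \<Rightarrow> 'b) \<Rightarrow> ('b \<Rightarrow> 'a set) \<Rightarrow> 'a \<Rightarrow> 'b \<times> bool" where
  "core_label p B x = (p x, x \<in> B (p x))"

definition core_weight :: "('a \<Rightarrow> 'b) \<Rightarrow> 'b \<times> bool \<Rightarrow> real" where
  "core_weight p = (\<lambda>(b, in_core). if in_core then 1 else 1 / real (card (range p)))"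

lemma core_weight_pos: "finite (range p) \<Longrightarrow> 0 < core_weight p s"
  by (simp add: core_weight_def card_gt_0_iff split: prod.split)

lemma sum_core_weight_le:
  assumes p: "finite (range p)" and one_core: "\<And>b. b \<in> range p \<Longrightarrow> A \<inter> B b \<noteq> {} \<Longrightarrow> b = j"
  shows "(\<Sum>s\<in>core_label p B ` A. core_weight p s) \<le> 2"
proof -
  have "core_label p B ` A \<subseteq> insert (j, True) ((\<lambda>b. (b, False)) ` range p)"
    using one_core by (fastforce simp: core_label_def)
  then have "(\<Sum>s\<in>core_label p B ` A. core_weight p s)
      \<le> (\<Sum>s\<in>insert (j, True) ((\<lambda>b. (b, False)) ` range p). core_weight p s)"
    using p core_weight_pos[OF p] by (intro sum_mono2) (auto intro: less_imp_le)
  also have "\<dots> = 1 + (\<Sum>b\<in>range p. 1 / real (card (range p)))"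
    using p by (subst sum.insert) (auto simp: sum.reindex inj_on_def core_weight_def)
  also have "\<dots> = 2" using p by (simp add: card_gt_0_iff)
  finally show ?thesis .
qed

context metric_finite_measure
begin

lemma simple_function_core_label:
  assumes p: "simple_function M p" and B: "\<And>b. B b \<in> sets M"
  shows "simple_function M (core_label p B)"
proof -
  note [simp] = space_borel_eq_UNIV
  have "{x. x \<in> B (p x)} = (\<Union>b\<in>range p. p -` {b} \<inter> B b)" by auto
  also have "\<dots> \<in> sets M"
    using simple_functionD[OF p] B by (intro sets.finite_UN sets.Int) auto
  finally have "simple_function M (\<lambda>x. if x \<in> B (p x) then (p x, True) else (p x, False))"
    by (intro simple_function_If simple_function_Pair p) auto
  then show ?thesis
    by (rule simple_function_cong[THEN iffD1, rotated]) (simp add: core_label_def)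
qed

lemma integral_ln_core_weight:
  assumes "finite (range p)"
  shows "(\<integral>x. ln (core_weight p (core_label p B x)) \<partial>M)
    = - ln (real (card (range p))) * measure M {x. x \<notin> B (p x)}"
proof -
  have "ln (core_weight p (core_label p B x))
      = - ln (real (card (range p))) * indicator {x. x \<notin> B (p x)} x" for x
    using assms by (simp add: core_weight_def core_label_def ln_div card_gt_0_iff)
  then show ?thesis by (simp add: space_borel_eq_UNIV)
qed

lemma weighted_refinement_exists:
  assumes compact: "compact (UNIV :: 'a set)" and p: "simple_function M p" and d: "0 < d"
  obtains r :: "'a \<Rightarrow> 'b \<times> bool" and t :: "'b \<times> bool \<Rightarrow> real" and e where
    "simple_function M r" "\<And>x. fst (r x) = p x" "\<And>s. 0 < t s" "- 1 \<le> (\<integral>x. ln (t (r x)) \<partial>M)"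
    "0 < e" "e \<le> d" "\<And>y. (\<Sum>s\<in>r ` ball y e. t s) \<le> 2"
proof -
  have finite_range: "finite (range p)"
    using simple_functionD(1)[OF p] by (simp add: space_borel_eq_UNIV)
  define k where "k = real (card (range p))"
  have "1 \<le> k" using finite_range by (simp add: k_def Suc_le_eq card_gt_0_iff)
  then have lnk: "0 \<le> ln k" "0 < 1 / (ln k + 1)" by (simp_all add: add_nonneg_pos)
  obtain B where B: "\<And>b. closed (B b)" "\<And>b. B b \<subseteq> p -` {b}"
    and small: "measure M {x. x \<notin> B (p x)} < 1 / (ln k + 1)"
    using simple_function_closed_cores[OF p lnk(2)] by blast
  have "ln k * measure M {x. x \<notin> B (p x)} \<le> ln k * (1 / (ln k + 1))"
    using lnk(1) small by (intro mult_left_mono) auto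
  also have "\<dots> \<le> 1" using lnk(1) by (simp add: add_nonneg_pos)
  finally have bound: "- 1 \<le> (\<integral>x. ln (core_weight p (core_label p B x)) \<partial>M)"
    by (simp add: integral_ln_core_weight[OF finite_range] k_def)
  have "disjoint_family_on B (range p)"
    by (auto simp: disjoint_family_on_def dest!: subsetD[OF B(2)])
  from compact_disjoint_closed_ball_meets_one[OF compact finite_range B(1) this]
  obtain e where e: "0 < e" "\<And>y. \<exists>j. \<forall>b\<in>range p. ball y e \<inter> B b \<noteq> {} \<longrightarrow> b = j" by blast
  have multiplicity: "(\<Sum>s\<in>core_label p B ` ball y (min e d). core_weight p s) \<le> 2" for y
  proof -
    obtain j where only_j: "\<And>b. b \<in> range p \<Longrightarrow> ball y e \<inter> B b \<noteq> {} \<Longrightarrow> b = j" using e(2) by blast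
    have "ball y (min e d) \<subseteq> ball y e" by auto
    then show ?thesis
      using only_j by (intro sum_core_weight_le[OF finite_range, of _ _ j]) blast
  qed
  have "simple_function M (core_label p B)"
    using B(1) by (intro simple_function_core_label p) (simp add: sets_eq_borel)
  from that[OF this _ core_weight_pos[OF finite_range] bound _ _ multiplicity] show ?thesis
    using e(1) d by (simp add: core_label_def)
qed

end

definition itinerary_weight ::
    "('a::metric_space \<Rightarrow> 'a) \<Rightarrow> ('a \<Rightarrow> real) \<Rightarrow> ('a \<Rightarrow> 'b) \<Rightarrow> ('b \<Rightarrow> real) \<Rightarrow>
      real \<Rightarrow> nat \<Rightarrow> 'a set \<Rightarrow> (nat \<Rightarrow> 'b) \<Rightarrow> real" where
  "itinerary_weight f \<psi> r t e n E c =
    (\<Sum>y\<in>{y \<in> E. c \<in> (\<Pi>\<^sub>E i\<in>{..<n}. r ` ball ((f ^^ i) y) e)}.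
      exp (birkhoff_sum f \<psi> n y) * (\<Prod>i<n. t (c i)))"

lemma sum_itinerary_weight_le:
  assumes finite_C: "finite C" and finite_E: "finite E" and finite_range: "finite (range r)"
    and t_pos: "\<And>s. 0 < t s"
    and multiplicity: "\<And>y. (\<Sum>s\<in>r ` ball y e. t s) \<le> L"
  shows "(\<Sum>c\<in>C. itinerary_weight f \<psi> r t e n E c) \<le> (\<Sum>y\<in>E. exp (birkhoff_sum f \<psi> n y)) * L ^ n"
proof -
  let ?N = "\<lambda>y. \<Pi>\<^sub>E i\<in>{..<n}. r ` ball ((f ^^ i) y) e" and ?S = "birkhoff_sum f \<psi> n"
  have finite_ball: "finite (r ` ball y e)" for y
    using finite_range by (rule finite_subset[rotated]) auto
  have "(\<Sum>c\<in>C. itinerary_weight f \<psi> r t e n E c)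
      = (\<Sum>y\<in>E. \<Sum>c\<in>{c \<in> C. c \<in> ?N y}. exp (?S y) * (\<Prod>i<n. t (c i)))"
    unfolding itinerary_weight_def by (rule sum.swap_restrict[OF finite_C finite_E])
  also have "\<dots> \<le> (\<Sum>y\<in>E. \<Sum>c\<in>?N y. exp (?S y) * (\<Prod>i<n. t (c i)))"
  proof (intro sum_mono sum_mono2)
    show "finite (?N y)" for y by (intro finite_PiE finite_ball) simp
    show "0 \<le> exp (?S y) * (\<Prod>i<n. t (c i))" for y c
      using t_pos by (intro mult_nonneg_nonneg prod_nonneg) (auto intro: less_imp_le)
  qed auto
  also have "\<dots> = (\<Sum>y\<in>E. exp (?S y) * (\<Prod>i<n. \<Sum>s\<in>r ` ball ((f ^^ i) y) e. t s))"
    by (simp add: prod_sum_PiE finite_ball sum_distrib_left)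
  also have "\<dots> \<le> (\<Sum>y\<in>E. exp (?S y) * (\<Prod>i<n. L))"
    using t_pos by (intro sum_mono mult_left_mono prod_mono conjI multiplicity sum_nonneg)
      (auto intro: less_imp_le)
  finally show ?thesis by (simp add: sum_distrib_right)
qed

lemma itinerary_weight_ge:
  assumes E: "finite E" "spanning f n \<delta> E" and \<delta>: "\<delta> < e" and t_pos: "\<And>s. 0 < t s"
    and oscillation: "\<And>x y. dist x y < e \<Longrightarrow> \<psi> x \<le> \<psi> y + c"
  shows "exp (birkhoff_sum f (\<lambda>x. \<psi> x + ln (t (r x))) n x - real n * c)
    \<le> itinerary_weight f \<psi> r t e n E (itinerary f n r x)"
proof -
  let ?S = "birkhoff_sum f \<psi> n" and ?c = "itinerary f n r x"
  have prod_pos: "0 < (\<Prod>i<n. t (s i))" for s using t_pos by (intro prod_pos) auto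
  obtain y where y: "y \<in> E" "\<And>i. i < n \<Longrightarrow> dist ((f ^^ i) x) ((f ^^ i) y) < e"
    using E(2) \<delta> unfolding spanning_def by (meson le_less_trans)
  have "?S x \<le> birkhoff_sum f (\<lambda>x. \<psi> x + c) n y"
    unfolding birkhoff_sum_def using oscillation y(2) by (intro sum_mono) auto
  then have "exp (?S x - real n * c) * (\<Prod>i<n. t (?c i)) \<le> exp (?S y) * (\<Prod>i<n. t (?c i))"
    using prod_pos by (simp add: birkhoff_sum_add_const)
  also have "\<dots> \<le> itinerary_weight f \<psi> r t e n E ?c"
    unfolding itinerary_weight_def
  proof (rule member_le_sum)
    show "y \<in> {y \<in> E. ?c \<in> (\<Pi>\<^sub>E i\<in>{..<n}. r ` ball ((f ^^ i) y) e)}"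
      using y by (auto simp: itinerary_def dist_commute)
  qed (use E(1) prod_pos in \<open>auto simp: less_imp_le\<close>)
  also have "exp (?S x - real n * c) * (\<Prod>i<n. t (?c i))
      = exp (birkhoff_sum f (\<lambda>x. \<psi> x + ln (t (r x))) n x - real n * c)"
    using t_pos by (simp add: birkhoff_sum_def sum.distrib exp_add exp_diff exp_sum itinerary_def)
  finally show ?thesis .
qed

locale compact_invariant_system =
  compact_dynamics f + measure_preserving_map M f + metric_finite_measure M
  for f :: "'a::metric_space \<Rightarrow> 'a" and M :: "'a measure"
begin

lemma compact_invariant_system_funpow: "compact_invariant_system (f ^^ n) M"
  by (intro compact_invariant_system.intro compact_dynamics_funpow measure_preserving_map_funpow
      metric_finite_measure_axioms)

lemma integrable_continuous:
  fixes \<phi> :: "'a \<Rightarrow> real"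
  assumes \<phi>: "continuous_on UNIV \<phi>" shows "integrable M \<phi>"
proof -
  obtain C where "\<And>x. \<bar>\<phi> x\<bar> \<le> C" using bounded_range_continuous[OF \<phi>] by (auto simp: bounded_iff)
  moreover have "\<phi> \<in> borel_measurable M"
    using borel_measurable_continuous_onI[OF \<phi>] sets_eq_borel by (simp cong: measurable_cong_sets)
  ultimately show ?thesis by (intro integrable_const_bound[of _ C]) auto
qed

lemma expectation_ln_itinerary_weight_ge:
  assumes r: "simple_function M r" and \<psi>: "integrable M \<psi>" and t_pos: "\<And>s. 0 < t s"
    and E: "finite E" "spanning f n \<delta> E" and \<delta>: "\<delta> < e"
    and oscillation: "\<And>x y. dist x y < e \<Longrightarrow> \<psi> x \<le> \<psi> y + c"
  shows "real n * (expectation \<psi> + expectation (\<lambda>x. ln (t (r x))) - c)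
    \<le> expectation (\<lambda>x. ln (itinerary_weight f \<psi> r t e n E (itinerary f n r x)))"
proof -
  let ?\<xi> = "\<lambda>x. \<psi> x + ln (t (r x))" and ?w = "itinerary_weight f \<psi> r t e n E"
  have weight: "exp (birkhoff_sum f ?\<xi> n x - real n * c) \<le> ?w (itinerary f n r x)" for x
    by (rule itinerary_weight_ge[OF E \<delta> t_pos oscillation])
  then have weight_pos: "0 < ?w (itinerary f n r x)" for x
    by (rule less_le_trans[OF exp_gt_zero])
  note integrable_ln_t = integrable_simple_function_comp[OF r, of "\<lambda>s. ln (t s)"]
  have \<xi>: "integrable M ?\<xi>" by (rule Bochner_Integration.integrable_add[OF \<psi> integrable_ln_t])
  have "real n * (expectation \<psi> + expectation (\<lambda>x. ln (t (r x))) - c)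
      = expectation (\<lambda>x. birkhoff_sum f ?\<xi> n x - real n * c)"
    using \<psi> \<xi> integrable_birkhoff_sum[OF \<xi>] integrable_ln_t
    by (simp add: integral_birkhoff_sum prob_UNIV right_diff_distrib)
  also have "\<dots> \<le> expectation (\<lambda>x. ln (?w (itinerary f n r x)))"
    using integrable_birkhoff_sum[OF \<xi>] weight weight_pos
      integrable_simple_function_comp[OF simple_function_itinerary[OF r], of "\<lambda>c. ln (?w c)"]
    by (intro integral_mono) (auto simp: ln_ge_iff)
  finally show ?thesis .
qed

lemma entropy_itinerary_le_ln_partition_function:
  assumes r: "simple_function M r" and \<psi>: "continuous_on UNIV \<psi>" and t_pos: "\<And>s. 0 < t s"
    and \<delta>: "0 < \<delta>" "\<delta> < e" and oscillation: "\<And>x y. dist x y < e \<Longrightarrow> \<psi> x \<le> \<psi> y + c"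
    and multiplicity: "\<And>y. (\<Sum>s\<in>r ` ball y e. t s) \<le> L"
  shows "\<H>(itinerary f n r) + real n * (expectation \<psi> + expectation (\<lambda>x. ln (t (r x))) - c)
    \<le> ln (partition_function f \<psi> n \<delta>) + real n * ln L"
proof -
  obtain E where E: "separated f n \<delta> E" "spanning f n \<delta> E"
    using separated_spanning_exists[OF \<delta>(1)] by blast
  then have finite_E: "finite E" by (simp add: separated_def)
  let ?w = "itinerary_weight f \<psi> r t e n E" and ?names = "range (itinerary f n r)"
  let ?Z = "partition_function f \<psi> n \<delta>"
  note names = simple_function_itinerary[OF r, of n] and bounded = bounded_range_continuous[OF \<psi>]
  have finite_labels: "finite (range r)" "finite ?names"
    using simple_functionD(1)[OF r] simple_functionD(1)[OF names] by simp_all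
  have "0 < (\<Sum>s\<in>r ` ball y e. t s)" for y
    using \<delta> t_pos finite_labels(1) by (intro sum_pos) (auto intro: finite_subset[of _ "range r"])
  then have L_pos: "0 < L" using multiplicity by (rule less_le_trans)
  have weight_pos: "0 < ?w (itinerary f n r x)" for x
    by (rule less_le_trans[OF exp_gt_zero
        itinerary_weight_ge[OF finite_E E(2) \<delta>(2) t_pos oscillation]])
  have "\<H>(itinerary f n r) + real n * (expectation \<psi> + expectation (\<lambda>x. ln (t (r x))) - c)
      \<le> \<H>(itinerary f n r) + expectation (\<lambda>x. ln (?w (itinerary f n r x)))"
    by (intro add_left_mono
        expectation_ln_itinerary_weight_ge[OF r _ t_pos finite_E E(2) \<delta>(2) oscillation]
        integrable_continuous \<psi>)
  also have "\<dots> \<le> ln (\<Sum>c\<in>?names. ?w c)"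
    using weight_pos by (intro gibbs_inequality names) auto
  also have "\<dots> \<le> ln (?Z * L ^ n)"
  proof (rule ln_mono)
    have "(\<Sum>c\<in>?names. ?w c) \<le> (\<Sum>y\<in>E. exp (birkhoff_sum f \<psi> n y)) * L ^ n"
      by (intro sum_itinerary_weight_le finite_E finite_labels t_pos multiplicity)
    also have "\<dots> \<le> ?Z * L ^ n"
      using L_pos by (intro mult_right_mono partition_function_upper[OF \<delta>(1) bounded E(1)]) simp
    finally show "(\<Sum>c\<in>?names. ?w c) \<le> ?Z * L ^ n" .
    show "0 < (\<Sum>c\<in>?names. ?w c)" using finite_labels(2) weight_pos by (intro sum_pos) auto
  qed
  also have "\<dots> = ln ?Z + real n * ln L"
    using partition_function_pos[OF \<delta>(1) bounded, of n] L_pos by (simp add: ln_mult ln_realpow)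
  finally show ?thesis .
qed

end

subsection \<open>The upper bound of the variational principle\<close>

context compact_invariant_system
begin

lemma entropy_rate_add_le_pressureI:
  assumes p: "simple_function M p" and \<psi>: "bounded (range \<psi>)" and \<delta>: "0 < \<delta>"
    and bound: "\<And>n. \<H>(itinerary f n p) + real n * c \<le> ln (partition_function f \<psi> n \<delta>)"
  shows "ereal (entropy_rate p + c) \<le> topological_pressure f \<psi>"
proof -
  let ?b = "\<lambda>n. \<H>(itinerary f n p) + real n * c"
  have "(\<lambda>n. \<H>(itinerary f n p) / real n + c) \<longlonglongrightarrow> entropy_rate p + c"
    by (intro tendsto_add entropy_rate_LIMSEQ[OF p] tendsto_const)
  then have "(\<lambda>n. ?b n / real n) \<longlonglongrightarrow> entropy_rate p + c"
    by (rule Lim_transform_eventually)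
      (intro eventually_sequentiallyI[of 1], simp add: add_divide_distrib)
  then have "ereal (entropy_rate p + c) = exponential_growth_rate (\<lambda>n. exp (?b n))"
    by (rule exponential_growth_rate_exp[symmetric])
  also have "\<dots> \<le> exponential_growth_rate (\<lambda>n. partition_function f \<psi> n \<delta>)"
    using bound partition_function_pos[OF \<delta> \<psi>]
    by (intro exponential_growth_rate_mono) (simp_all add: ln_ge_iff)
  also have "\<dots> \<le> topological_pressure f \<psi>"
    by (rule topological_pressure_upper[OF \<delta> \<psi>])
  finally show ?thesis .
qed

lemma entropy_rate_add_expectation_le_pressure_add_const:
  assumes \<psi>: "continuous_on UNIV \<psi>" and p: "simple_function M p"
  shows "ereal (entropy_rate p + expectation \<psi>) \<le> topological_pressure f \<psi> + ereal (ln 2 + 2)"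
proof -
  have "uniformly_continuous_on UNIV \<psi>" by (rule compact_uniformly_continuous[OF \<psi> compact_UNIV])
  then obtain d where d: "0 < d" "\<And>x y. dist x y < d \<Longrightarrow> dist (\<psi> x) (\<psi> y) < 1"
    unfolding uniformly_continuous_on_def by (metis UNIV_I dist_commute zero_less_one)
  obtain r :: "'a \<Rightarrow> 'b \<times> bool" and t :: "'b \<times> bool \<Rightarrow> real" and e
    where r: "simple_function M r" "\<And>x. fst (r x) = p x" and t_pos: "\<And>s. 0 < t s"
    and ln_t_ge: "- 1 \<le> expectation (\<lambda>x. ln (t (r x)))" and e: "0 < e" "e \<le> d"
    and multiplicity: "\<And>y. (\<Sum>s\<in>r ` ball y e. t s) \<le> 2"
    using weighted_refinement_exists[OF compact_UNIV p d(1)] by blast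
  have oscillation: "\<psi> x \<le> \<psi> y + 1" if "dist x y < e" for x y
    using d(2)[of x y] that e(2) by (simp add: dist_real_def abs_less_iff)
  let ?K = "ln 2 + 2 :: real"
  have "\<H>(itinerary f n p) + real n * (expectation \<psi> - ?K)
      \<le> ln (partition_function f \<psi> n (e / 2))" for n
  proof -
    have "\<H>(itinerary f n p) \<le> \<H>(itinerary f n r)"
      by (intro entropy_mono simple_function_itinerary r(1)) (simp add: itinerary_eq_iff flip: r(2))
    moreover have "\<H>(itinerary f n r)
        + real n * (expectation \<psi> + expectation (\<lambda>x. ln (t (r x))) - 1)
        \<le> ln (partition_function f \<psi> n (e / 2)) + real n * ln 2"
      using e(1)
      by (intro entropy_itinerary_le_ln_partition_function[OF r(1) \<psi> t_pos
          _ _ oscillation multiplicity])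
        simp_all
    moreover have "real n * - 1 \<le> real n * expectation (\<lambda>x. ln (t (r x)))"
      by (intro mult_left_mono ln_t_ge) simp
    ultimately show ?thesis by (simp add: algebra_simps)
  qed
  then have "ereal (entropy_rate p + (expectation \<psi> - ?K)) \<le> topological_pressure f \<psi>"
    by (rule entropy_rate_add_le_pressureI[OF p bounded_range_continuous[OF \<psi>]
        half_gt_zero[OF e(1)]])
  then show ?thesis by (cases "topological_pressure f \<psi>") auto
qed

lemma entropy_rate_add_expectation_le_pressure:
  assumes \<phi>: "continuous_on UNIV \<phi>" and p: "simple_function M p"
  shows "ereal (entropy_rate p + expectation \<phi>) \<le> topological_pressure f \<phi>"
proof -
  let ?h = "entropy_rate p + expectation \<phi>" and ?K = "ln 2 + 2 :: real"
  have iterated: "ereal (real m * ?h)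
      \<le> ereal (real m) * topological_pressure f \<phi> + ereal ?K" if m: "0 < m" for m
  proof -
    interpret iterate: compact_invariant_system "f ^^ m" M by (rule compact_invariant_system_funpow)
    have "real m * ?h = iterate.entropy_rate (itinerary f m p) + expectation (birkhoff_sum f \<phi> m)"
      using entropy_rate_funpow[OF p m] integral_birkhoff_sum[OF integrable_continuous[OF \<phi>]]
      by (simp add: distrib_left)
    then have "ereal (real m * ?h) \<le> topological_pressure (f ^^ m) (birkhoff_sum f \<phi> m) + ereal ?K"
      using iterate.entropy_rate_add_expectation_le_pressure_add_const[OF
          continuous_on_birkhoff_sum[OF \<phi>] simple_function_itinerary[OF p]] by simp
    also have "\<dots> \<le> ereal (real m) * topological_pressure f \<phi> + ereal ?K"
      by (intro add_right_mono topological_pressure_funpow_le bounded_range_continuous \<phi> m)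
    finally show ?thesis .
  qed
  show ?thesis
  proof (cases "topological_pressure f \<phi>")
    case (real P)
    have "?h \<le> P + ?K / real m" if "1 \<le> m" for m
      using iterated[of m] that by (simp add: real field_simps)
    moreover have "(\<lambda>m. P + ?K / real m) \<longlonglongrightarrow> P + 0"
      by (intro tendsto_intros lim_const_over_n)
    ultimately have "?h \<le> P + 0" by (intro LIMSEQ_le_const) auto
    then show ?thesis by (simp add: real)
  qed (use iterated[of 1] in auto)
qed

theorem measure_pressure_le_topological_pressure:
  assumes \<phi>: "continuous_on UNIV \<phi>"
  shows "measure_pressure M f \<phi> \<le> topological_pressure f \<phi>"
proof -
  have "metric_entropy M f \<le> topological_pressure f \<phi> - ereal (expectation \<phi>)"
    using entropy_rate_add_expectation_le_pressure[OF \<phi>]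
    by (intro metric_entropy_least) (simp add: ereal_le_minus)
  then show ?thesis by (simp add: measure_pressure_def ereal_le_minus)
qed

end

subsection \<open>Weak-Gibbs measures\<close>

lemma (in prob_space) AE_liminf_ge_imp_LIMSEQ_expectation_ge:
  fixes u :: "nat \<Rightarrow> 'a \<Rightarrow> real"
  assumes u: "\<And>n. integrable M (u n)" "\<And>n x. - D \<le> u n x"
    and LIMSEQ: "(\<lambda>n. expectation (u n)) \<longlonglongrightarrow> L"
    and AE: "AE x in M. ereal c \<le> liminf (\<lambda>n. ereal (u n x))"
  shows "c \<le> L"
proof -
  have [measurable]: "u n \<in> borel_measurable M" for n using u(1) by simp
  have "AE x in M. (\<lambda>n. min (u n x) c) \<longlonglongrightarrow> c"
    using AE
  proof eventually_elim
    case (elim x)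
    show ?case
    proof (rule order_tendstoI)
      fix a assume "a < c"
      then have "ereal a < ereal c" by simp
      then have "\<forall>\<^sub>F n in sequentially. ereal a < ereal (u n x)"
        using elim unfolding le_Liminf_iff by blast
      with \<open>a < c\<close> show "\<forall>\<^sub>F n in sequentially. a < min (u n x) c"
        by (auto elim: eventually_mono)
    qed (auto intro: always_eventually)
  qed
  then have "(\<lambda>n. expectation (\<lambda>x. min (u n x) c)) \<longlonglongrightarrow> expectation (\<lambda>_. c)"
  proof (rule integral_dominated_convergence[rotated 3])
    have "norm (min (u n x) c) \<le> \<bar>D\<bar> + \<bar>c\<bar>" for n x
      using u(2)[of n x] unfolding real_norm_def by linarith
    then show "AE x in M. norm (min (u n x) c) \<le> \<bar>D\<bar> + \<bar>c\<bar>" for n by simp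
  qed auto
  then have "(\<lambda>n. expectation (\<lambda>x. min (u n x) c)) \<longlonglongrightarrow> c" by (simp add: prob_space)
  then show ?thesis
    using LIMSEQ by (rule LIMSEQ_le) (auto intro!: integral_mono integrable_min u(1))
qed

lemma (in measure_preserving_map) AE_liminf_self_information_ge_imp_entropy_rate_ge:
  assumes p: "simple_function M p" and \<phi>: "integrable M \<phi>" "\<And>x. \<bar>\<phi> x\<bar> \<le> C"
    and AE: "AE x in M. ereal c
      \<le> liminf (\<lambda>n. ereal ((self_information (itinerary f n p) x + birkhoff_sum f \<phi> n x) / real n))"
  shows "c \<le> entropy_rate p + expectation \<phi>"
proof (rule AE_liminf_ge_imp_LIMSEQ_expectation_ge[OF _ _ _ AE])
  note simple_itinerary = simple_function_itinerary[OF p]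
  let ?u = "\<lambda>n x. (self_information (itinerary f n p) x + birkhoff_sum f \<phi> n x) / real n"
  show "integrable M (?u n)" for n
    by (intro integrable_divide Bochner_Integration.integrable_add integrable_self_information
        simple_itinerary integrable_birkhoff_sum \<phi>)
  show "- C \<le> ?u n x" for n x
  proof (cases "n = 0")
    case False
    have "- (real n * C) \<le> birkhoff_sum f \<phi> n x"
      using abs_birkhoff_sum_le[of \<phi> C f n x] \<phi>(2) by (simp add: abs_le_iff)
    then have "- (real n * C) \<le> self_information (itinerary f n p) x + birkhoff_sum f \<phi> n x"
      by (intro add_increasing self_information_nonneg)
    then show ?thesis using False by (simp add: field_simps)
  qed (use \<phi>(2)[of x] in simp)
  have "(\<lambda>n. \<H>(itinerary f n p) / real n + expectation \<phi>) \<longlonglongrightarrow> entropy_rate p + expectation \<phi>"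
    by (intro tendsto_add entropy_rate_LIMSEQ[OF p] tendsto_const)
  moreover have "\<H>(itinerary f n p) / real n + expectation \<phi> = expectation (?u n)" if "1 \<le> n" for n
    using that integrable_self_information[OF simple_itinerary] integrable_birkhoff_sum[OF \<phi>(1)]
    by (simp add: entropy_eq_expectation_self_information[OF simple_itinerary]
        integral_birkhoff_sum[OF \<phi>(1)] add_divide_distrib)
  ultimately show "(\<lambda>n. expectation (?u n)) \<longlonglongrightarrow> entropy_rate p + expectation \<phi>"
    by (elim Lim_transform_eventually) (intro eventually_sequentiallyI[of 1])
qed

lemma liminf_ge_of_subexponential_bound:
  fixes a s \<delta> :: "nat \<Rightarrow> real"
  assumes \<delta>: "(\<lambda>n. ln (\<delta> n) / real n) \<longlonglongrightarrow> 0" "\<And>n. 1 \<le> n \<Longrightarrow> 0 < \<delta> n"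
    and a_bounds: "\<And>n. 0 < a n" "\<And>n. 1 \<le> n \<Longrightarrow> a n \<le> \<delta> n * exp (- P * real n + s n)"
  shows "ereal P \<le> liminf (\<lambda>n. ereal ((- ln (a n) + s n) / real n))"
proof -
  have "P - ln (\<delta> n) / real n \<le> (- ln (a n) + s n) / real n" if n: "1 \<le> n" for n
  proof -
    have "ln (a n) \<le> ln (\<delta> n * exp (- P * real n + s n))" using a_bounds n by (intro ln_mono) auto
    also have "\<dots> = ln (\<delta> n) + (- P * real n + s n)"
      using \<delta>(2)[OF n] by (simp add: ln_mult)
    finally have "(P * real n - ln (\<delta> n)) / real n \<le> (- ln (a n) + s n) / real n"
      by (intro divide_right_mono) auto
    then show ?thesis using n by (simp add: diff_divide_distrib)
  qed
  then have "liminf (\<lambda>n. ereal (P - ln (\<delta> n) / real n))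
      \<le> liminf (\<lambda>n. ereal ((- ln (a n) + s n) / real n))"
    by (intro Liminf_mono eventually_sequentiallyI[of 1]) simp
  moreover have "(\<lambda>n. P - ln (\<delta> n) / real n) \<longlonglongrightarrow> P - 0"
    by (intro tendsto_intros \<delta>(1))
  then have "liminf (\<lambda>n. ereal (P - ln (\<delta> n) / real n)) = ereal P"
    by (intro lim_imp_Liminf) auto
  ultimately show ?thesis by simp
qed

lemma (in metric_finite_measure) simple_function_small_fibres_exists:
  assumes compact: "compact (UNIV :: 'a set)" and \<epsilon>: "0 < \<epsilon>"
  obtains p :: "'a \<Rightarrow> 'a set" where "simple_function M p" "\<And>x y. p x = p y \<Longrightarrow> dist x y < \<epsilon>"
proof -
  have "(UNIV :: 'a set) \<subseteq> (\<Union>t\<in>UNIV. ball t (\<epsilon> / 2))" using \<epsilon> by auto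
  then obtain T where T: "finite T" "(UNIV :: 'a set) \<subseteq> (\<Union>t\<in>T. ball t (\<epsilon> / 2))"
    using compactE_image[OF compact] open_ball by metis
  define p where "p x = {t \<in> T. x \<in> ball t (\<epsilon> / 2)}" for x
  have "simple_function M p"
    unfolding p_def using T(1) by (intro simple_function_Collect) (auto simp: sets_eq_borel)
  moreover have "dist x y < \<epsilon>" if "p x = p y" for x y
  proof -
    have "x \<in> (\<Union>t\<in>T. ball t (\<epsilon> / 2))" using T(2) by blast
    then obtain t where "t \<in> p x" by (auto simp: p_def)
    moreover from this have "t \<in> p y" using that by simp
    ultimately have "dist t x < \<epsilon> / 2" "dist t y < \<epsilon> / 2" by (simp_all add: p_def)
    then show ?thesis by (rule dist_triangle_half_r)
  qed
  ultimately show ?thesis using that by blast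
qed

lemma weak_gibbsE:
  assumes "weak_gibbs f \<phi> M"
  obtains \<epsilon> \<Lambda> where "0 < \<epsilon>" "\<Lambda> \<in> sets M" "measure M \<Lambda> = 1"
    "\<And>x. x \<in> \<Lambda> \<Longrightarrow> \<exists>\<delta>. (\<forall>n\<ge>1. 0 < \<delta> n) \<and> (\<lambda>n. ln (\<delta> n) / real n) \<longlonglongrightarrow> 0 \<and>
      (\<forall>n\<ge>1. measure M (dynamical_ball f n x \<epsilon>) \<le>
        \<delta> n * exp (- real_of_ereal (topological_pressure f \<phi>) * real n + birkhoff_sum f \<phi> n x))"
proof -
  obtain \<epsilon>\<^sub>0 \<Lambda> where "0 < \<epsilon>\<^sub>0" and \<Lambda>: "\<Lambda> \<in> sets M" "measure M \<Lambda> = 1"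
    and gibbs: "\<forall>\<epsilon> x. 0 < \<epsilon> \<and> \<epsilon> < \<epsilon>\<^sub>0 \<and> x \<in> \<Lambda> \<longrightarrow> (\<exists>\<delta> :: nat \<Rightarrow> real. (\<forall>n\<ge>1. 0 < \<delta> n) \<and>
      (\<lambda>n. ln (\<delta> n) / real n) \<longlonglongrightarrow> 0 \<and> (\<forall>n\<ge>1. let r = measure M (dynamical_ball f n x \<epsilon>) /
          exp (- real_of_ereal (topological_pressure f \<phi>) * real n + birkhoff_sum f \<phi> n x)
        in inverse (\<delta> n) \<le> r \<and> r \<le> \<delta> n))"
    using assms unfolding weak_gibbs_def by blast
  show ?thesis
  proof (rule that[OF _ \<Lambda>])
    show "0 < \<epsilon>\<^sub>0 / 2" using \<open>0 < \<epsilon>\<^sub>0\<close> by simp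
    fix x assume "x \<in> \<Lambda>"
    then obtain \<delta> :: "nat \<Rightarrow> real" where "\<forall>n\<ge>1. 0 < \<delta> n" "(\<lambda>n. ln (\<delta> n) / real n) \<longlonglongrightarrow> 0"
      and "\<forall>n\<ge>1. let r = measure M (dynamical_ball f n x (\<epsilon>\<^sub>0 / 2)) /
          exp (- real_of_ereal (topological_pressure f \<phi>) * real n + birkhoff_sum f \<phi> n x)
        in inverse (\<delta> n) \<le> r \<and> r \<le> \<delta> n"
      using gibbs[rule_format, of "\<epsilon>\<^sub>0 / 2" x] \<open>0 < \<epsilon>\<^sub>0\<close> by auto
    then show "\<exists>\<delta>. (\<forall>n\<ge>1. 0 < \<delta> n) \<and> (\<lambda>n. ln (\<delta> n) / real n) \<longlonglongrightarrow> 0 \<and>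
      (\<forall>n\<ge>1. measure M (dynamical_ball f n x (\<epsilon>\<^sub>0 / 2)) \<le>
        \<delta> n * exp (- real_of_ereal (topological_pressure f \<phi>) * real n + birkhoff_sum f \<phi> n x))"
      by (intro exI[of _ \<delta>] conjI) (simp_all add: Let_def divide_le_eq)
  qed
qed

context compact_invariant_system
begin

lemma weak_gibbs_AE_liminf_self_information_ge:
  assumes "weak_gibbs f \<phi> M"
  obtains \<epsilon> where "0 < \<epsilon>"
    "\<And>p :: 'a \<Rightarrow> 'b. simple_function M p \<Longrightarrow> (\<And>x y. p x = p y \<Longrightarrow> dist x y < \<epsilon>) \<Longrightarrow>
      AE x in M. ereal (real_of_ereal (topological_pressure f \<phi>)) \<le>
        liminf (\<lambda>n. ereal ((self_information (itinerary f n p) x + birkhoff_sum f \<phi> n x) / real n))"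
proof -
  let ?P = "real_of_ereal (topological_pressure f \<phi>)"
  obtain \<epsilon> \<Lambda> where \<epsilon>: "0 < \<epsilon>" and \<Lambda>: "\<Lambda> \<in> sets M" "prob \<Lambda> = 1"
    and gibbs: "\<And>x. x \<in> \<Lambda> \<Longrightarrow>
      \<exists>\<delta>. (\<forall>n\<ge>1. 0 < \<delta> n) \<and> (\<lambda>n. ln (\<delta> n) / real n) \<longlonglongrightarrow> 0 \<and>
        (\<forall>n\<ge>1. prob (dynamical_ball f n x \<epsilon>) \<le> \<delta> n * exp (- ?P * real n + birkhoff_sum f \<phi> n x))"
    using weak_gibbsE[OF assms] by blast
  have "AE x in M. ereal ?P \<le>
      liminf (\<lambda>n. ereal ((self_information (itinerary f n p) x + birkhoff_sum f \<phi> n x) / real n))"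
    if p: "simple_function M p" and small: "\<And>x y. p x = p y \<Longrightarrow> dist x y < \<epsilon>" for p :: "'a \<Rightarrow> 'b"
  proof -
    let ?cell = "\<lambda>n x. itinerary f n p -` {itinerary f n p x}"
    have "AE x in M. \<forall>n. 0 < prob (?cell n x)"
      using AE_prob_fibre_pos[OF simple_function_itinerary[OF p]] by (simp add: AE_all_countable)
    moreover have "AE x in M. x \<in> \<Lambda>" using \<Lambda>(2) by (rule AE_prob_1)
    ultimately show ?thesis
    proof eventually_elim
      case (elim x)
      obtain \<delta> where \<delta>: "\<forall>n\<ge>1. 0 < \<delta> n" "(\<lambda>n. ln (\<delta> n) / real n) \<longlonglongrightarrow> 0"
        "\<forall>n\<ge>1. prob (dynamical_ball f n x \<epsilon>) \<le> \<delta> n * exp (- ?P * real n + birkhoff_sum f \<phi> n x)"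
        using gibbs[OF elim(2)] by blast
      have "?cell n x \<subseteq> dynamical_ball f n x \<epsilon>" for n
        using small by (auto simp: itinerary_eq_iff dynamical_ball_def)
      then have "prob (?cell n x) \<le> prob (dynamical_ball f n x \<epsilon>)" for n
        by (intro finite_measure_mono) (simp_all add: sets_eq_borel open_dynamical_ball)
      then have "prob (?cell n x) \<le> \<delta> n * exp (- ?P * real n + birkhoff_sum f \<phi> n x)"
        if "1 \<le> n" for n
        using \<delta>(3) that by (meson order_trans)
      then have "ereal ?P
          \<le> liminf (\<lambda>n. ereal ((- ln (prob (?cell n x)) + birkhoff_sum f \<phi> n x) / real n))"
        using elim(1) \<delta>(1) by (intro liminf_ge_of_subexponential_bound[OF \<delta>(2)]) auto
      then show ?case by (simp add: self_information_def)
    qed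
  qed
  then show ?thesis by (rule that[OF \<epsilon>])
qed

theorem weak_gibbs_imp_pressure_le_measure_pressure:
  assumes \<phi>: "continuous_on UNIV \<phi>" and gibbs: "weak_gibbs f \<phi> M"
  shows "ereal (real_of_ereal (topological_pressure f \<phi>)) \<le> measure_pressure M f \<phi>"
proof -
  let ?P = "real_of_ereal (topological_pressure f \<phi>)"
  obtain \<epsilon> where \<epsilon>: "0 < \<epsilon>"
    and liminf: "\<And>p :: 'a \<Rightarrow> 'a set. simple_function M p \<Longrightarrow> (\<And>x y. p x = p y \<Longrightarrow> dist x y < \<epsilon>) \<Longrightarrow>
      AE x in M. ereal ?P \<le>
        liminf (\<lambda>n. ereal ((self_information (itinerary f n p) x + birkhoff_sum f \<phi> n x) / real n))"
    using weak_gibbs_AE_liminf_self_information_ge[OF gibbs] by blast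
  obtain p :: "'a \<Rightarrow> 'a set" where p: "simple_function M p" "\<And>x y. p x = p y \<Longrightarrow> dist x y < \<epsilon>"
    using simple_function_small_fibres_exists[OF compact_UNIV \<epsilon>] by blast
  obtain C where "\<And>x. \<bar>\<phi> x\<bar> \<le> C" using bounded_range_continuous[OF \<phi>] by (auto simp: bounded_iff)
  then have "?P \<le> entropy_rate p + expectation \<phi>"
    by (intro AE_liminf_self_information_ge_imp_entropy_rate_ge[OF p(1)
          integrable_continuous[OF \<phi>] _ liminf[OF p]])
  then have "ereal ?P \<le> ereal (entropy_rate p) + ereal (expectation \<phi>)" by simp
  also have "\<dots> \<le> measure_pressure M f \<phi>"
    unfolding measure_pressure_def by (intro add_right_mono entropy_rate_le_metric_entropy p(1))
  finally show ?thesis .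
qed

end

lemma compact_invariant_systemI:
  fixes f :: "'a::metric_space \<Rightarrow> 'a"
  assumes "compact (UNIV :: 'a set)" "continuous_on UNIV f" and M: "invariant_prob f M"
  shows "compact_invariant_system f M"
proof -
  have prob: "prob_space M" and sets: "sets M = sets borel" and f: "f \<in> borel_measurable borel"
    and invariant: "\<And>A. A \<in> sets borel \<Longrightarrow> measure M (f -` A) = measure M A"
    using M by (auto simp: invariant_prob_def borel_prob_def)
  interpret prob_space M by (rule prob)
  have space: "space M = UNIV" using sets_eq_imp_space_eq[OF sets] by simp
  have measurable: "f \<in> measurable M M" using f sets by (simp cong: measurable_cong_sets)
  have "distr M M f = M"
    using measurable invariant
    by (intro measure_eqI) (simp_all add: emeasure_distr emeasure_eq_measure space sets)
  then show ?thesis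
    using assms(1,2) space measurable sets by unfold_locales
qed

theorem corollary1:
  fixes f :: "'a::metric_space \<Rightarrow> 'a" and \<phi> :: "'a \<Rightarrow> real" and \<mu> :: "'a measure"
  assumes "compact (UNIV :: 'a set)"
    and "continuous_on UNIV f"
    and "topological_entropy f < \<infinity>"
    and "invariant_prob f \<mu>"
    and "non_atomic \<mu>"
    and "continuous_on UNIV \<phi>"
    and "weak_gibbs f \<phi> \<mu>"
  shows "equilibrium_state f \<phi> \<mu>"
proof -
  note system = compact_invariant_systemI[OF assms(1,2)]
  interpret compact_invariant_system f \<mu> by (rule system[OF assms(4)])
  have "\<bar>topological_pressure f \<phi>\<bar> \<noteq> \<infinity>"
    by (rule topological_pressure_finite[OF bounded_range_continuous[OF assms(6)] assms(3)])
  then have "topological_pressure f \<phi> \<le> measure_pressure \<mu> f \<phi>"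
    using weak_gibbs_imp_pressure_le_measure_pressure[OF assms(6,7)] by (simp add: ereal_real)
  moreover have "measure_pressure N f \<phi> \<le> topological_pressure f \<phi>" if "invariant_prob f N" for N
    by (rule compact_invariant_system.measure_pressure_le_topological_pressure[OF
          system[OF that] assms(6)])
  ultimately have "measure_pressure \<mu> f \<phi> = (SUP N\<in>{N. invariant_prob f N}. measure_pressure N f \<phi>)"
    using assms(4) by (intro antisym SUP_upper SUP_least) (auto intro: order_trans)
  then show ?thesis using assms(4) by (simp add: equilibrium_state_def)
qed

end
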